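(* For every derivation $\mathcal{D} \in \mathsf{PLL}$, there is a cut-free derivation $\mathcal{D}'\in\mathsf{PLL}$ such that $\mathcal{D}\to_{\mathsf{cut}}^*\mathcal{D}'$.
   Context: Formulas are those of propositional multiplicative-exponential linear logic with units: $A,B ::= X \mid X^\perp \mid A\otimes B \mid A ⅋ B \mid {!A} \mid {?A} \mid \mathbf{1} \mid \bot$, where $X$ ranges over propositional variables and $⅋$ denotes the multiplicative disjunction ("par"); linear negation $(\cdot)^\perp$ is involutive and defined by De Morgan laws ($(A\otimes B)^\perp = A^\perp ⅋ B^\perp$, $(!A)^\perp = ?A^\perp$, $\mathbf{1}^\perp=\bot$). Sequents are sets of formula occurrences. Parsimonious linear logic $\mathsf{PLL}$ is the set of finite derivations built from the rules: axiom ($\vdash A, A^\perp$), cut (from $\Gamma,A$ and $A^\perp,\Delta$ infer $\Gamma,\Delta$), $⅋$ (from $\Gamma,A,B$ infer $\Gamma,A⅋B$), $\otimes$ (from $\Gamma,A$ and $B,\Delta$ infer $\Gamma,\Delta,A\otimes B$), $\mathbf{1}$ ($\vdash\mathbf{1}$), $\bot$ (from $\Gamma$ infer $\Gamma,\bot$), functorial promotion $\mathsf{fp}$ (from $\Gamma,A$ infer $?\Gamma,!A$), weakening $?\mathsf{w}$ (from $\Gamma$ infer $\Gamma,?A$) and absorption $?\mathsf{b}$ (from $\Gamma,A,?A$ infer $\Gamma,?A$). The cut-elimination relation $\to_{\mathsf{cut}}$ (with reflexive-transitive closure $\to_{\mathsf{cut}}^*$) is the union of: the multiplicative principal steps (a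 cut with an axiom disappears; a cut between $⅋$ and $\otimes$ on $A⅋B$ / $A^\perp\otimes B^\perp$ becomes two cuts on $A$ and $B$; a cut between $\bot$ and $\mathbf{1}$ disappears); the exponential principal steps ($\mathsf{fp}$ vs $\mathsf{fp}$: a cut between $\mathsf{fp}$ on $\Gamma,A$ and $\mathsf{fp}$ on $A^\perp,\Delta,B$ becomes an $\mathsf{fp}$ applied to the cut of their premises; $\mathsf{fp}$ vs $?\mathsf{w}$: becomes weakenings introducing $?\Gamma$; $\mathsf{fp}$ vs $?\mathsf{b}$ with premises $\Gamma,A$ and $\Delta,A^\perp,?A^\perp$: becomes absorptions on $?\Gamma$ applied to the cut of $\Gamma,A$ with the cut of the $\mathsf{fp}$-derivation of $?\Gamma,!A$ and $\Delta,A^\perp,?A^\perp$); and the commutative steps, which permute a cut above a rule $\mathsf{r}\neq\mathsf{cut}$ whose principal formula is not the cut formula. *)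

theory Defs
  imports Main
begin

datatype 'v form =
    Var 'v
  | NVar 'v
  | Tensor "'v form" "'v form"
  | Par "'v form" "'v form"
  | Bang "'v form"
  | Quest "'v form"
  | One
  | Bot

primrec neg :: "'v form \<Rightarrow> 'v form" where
  "neg (Var X) = NVar X"
| "neg (NVar X) = Var X"
| "neg (Tensor A B) = Par (neg A) (neg B)"
| "neg (Par A B) = Tensor (neg A) (neg B)"
| "neg (Bang A) = Quest (neg A)"
| "neg (Quest A) = Bang (neg A)"
| "neg One = Bot"
| "neg Bot = One"

lemma neg_neg [simp]: "neg (neg A) = A"
  by (induction A) simp_all

text \<open>
  A sequent is a set of formula occurrences: a finite partial map from names to formulas.
  (Finiteness is not imposed; it holds for every sequent that has a derivation.)
  Exchange is therefore implicit, and two occurrences of one formula stay distinct.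

  Occurrence names are handled in the style of de Bruijn, so that no quotient by renaming
  of occurrences is needed. In a premise of a rule, the active occurrences that disappear
  in the conclusion are numbered from 0, and the names of the remaining occurrences
  are shifted up accordingly.
\<close>

type_synonym 'v sequent = "nat \<Rightarrow> 'v form option"

definition bind :: "'v form \<Rightarrow> 'v sequent \<Rightarrow> 'v sequent" where
  "bind A \<Gamma> = case_nat (Some A) \<Gamma>"

definition gap :: "'v sequent \<Rightarrow> 'v sequent" where
  "gap \<Gamma> = case_nat None \<Gamma>"

text \<open>
  Derivation trees. The number arguments name the principal occurrences in the conclusion:
  \<open>AxR x y A\<close> concludes with \<open>x : A\<close> and \<open>y : neg A\<close>. The formula in \<open>CutR\<close> is the cut
  formula of the left premise, the one in \<open>WkR x A\<close> is the \<open>A\<close> of the weakened \<open>Quest A\<close>.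
\<close>

datatype 'v deriv =
    AxR nat nat "'v form"
  | CutR "'v form" "'v deriv" "'v deriv"
  | ParR nat "'v deriv"
  | TensorR nat "'v deriv" "'v deriv"
  | OneR nat
  | BotR nat "'v deriv"
  | FpR nat "'v deriv"
  | WkR nat "'v form" "'v deriv"
  | AbsR nat "'v deriv"

text \<open>
  In absorption, the occurrence of \<open>Quest A\<close> in the premise bears the same name as the
  principal occurrence of \<open>Quest A\<close> in the conclusion; only \<open>A\<close> disappears.
\<close>

inductive proves :: "'v deriv \<Rightarrow> 'v sequent \<Rightarrow> bool" where
  ax: "x \<noteq> y \<Longrightarrow> proves (AxR x y A) [x \<mapsto> A, y \<mapsto> neg A]"
| cut: "\<lbrakk>proves D (bind A \<Gamma>); proves E (bind (neg A) \<Delta>); dom \<Gamma> \<inter> dom \<Delta> = {}\<rbrakk>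
    \<Longrightarrow> proves (CutR A D E) (\<Gamma> ++ \<Delta>)"
| par: "\<lbrakk>proves D (bind A (bind B \<Gamma>)); x \<notin> dom \<Gamma>\<rbrakk>
    \<Longrightarrow> proves (ParR x D) (\<Gamma>(x \<mapsto> Par A B))"
| tensor: "\<lbrakk>proves D (bind A \<Gamma>); proves E (bind B \<Delta>); dom \<Gamma> \<inter> dom \<Delta> = {}; x \<notin> dom \<Gamma> \<union> dom \<Delta>\<rbrakk>
    \<Longrightarrow> proves (TensorR x D E) ((\<Gamma> ++ \<Delta>)(x \<mapsto> Tensor A B))"
| one: "proves (OneR x) [x \<mapsto> One]"
| bot: "\<lbrakk>proves D \<Gamma>; x \<notin> dom \<Gamma>\<rbrakk> \<Longrightarrow> proves (BotR x D) (\<Gamma>(x \<mapsto> Bot))"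
| fp: "\<lbrakk>proves D (bind A \<Gamma>); x \<notin> dom \<Gamma>\<rbrakk>
    \<Longrightarrow> proves (FpR x D) ((map_option Quest \<circ> \<Gamma>)(x \<mapsto> Bang A))"
| wk: "\<lbrakk>proves D \<Gamma>; x \<notin> dom \<Gamma>\<rbrakk> \<Longrightarrow> proves (WkR x A D) (\<Gamma>(x \<mapsto> Quest A))"
| abs: "\<lbrakk>proves D (bind A \<Gamma>); \<Gamma> x = Some (Quest A)\<rbrakk> \<Longrightarrow> proves (AbsR x D) \<Gamma>"

definition PLL :: "'v deriv set" where
  "PLL = {D. \<exists>\<Gamma>. proves D \<Gamma>}"

primrec cut_free :: "'v deriv \<Rightarrow> bool" where
  "cut_free (AxR x y A) \<longleftrightarrow> True"
| "cut_free (CutR A D E) \<longleftrightarrow> False"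
| "cut_free (ParR x D) \<longleftrightarrow> cut_free D"
| "cut_free (TensorR x D E) \<longleftrightarrow> cut_free D \<and> cut_free E"
| "cut_free (OneR x) \<longleftrightarrow> True"
| "cut_free (BotR x D) \<longleftrightarrow> cut_free D"
| "cut_free (FpR x D) \<longleftrightarrow> cut_free D"
| "cut_free (WkR x A D) \<longleftrightarrow> cut_free D"
| "cut_free (AbsR x D) \<longleftrightarrow> cut_free D"

definition lift :: "(nat \<Rightarrow> nat) \<Rightarrow> nat \<Rightarrow> nat" where
  "lift f = case_nat 0 (\<lambda>n. Suc (f n))"

primrec rename :: "(nat \<Rightarrow> nat) \<Rightarrow> 'v deriv \<Rightarrow> 'v deriv" where
  "rename f (AxR x y A) = AxR (f x) (f y) A"
| "rename f (CutR A D E) = CutR A (rename (lift f) D) (rename (lift f) E)"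
| "rename f (ParR x D) = ParR (f x) (rename (lift (lift f)) D)"
| "rename f (TensorR x D E) = TensorR (f x) (rename (lift f) D) (rename (lift f) E)"
| "rename f (OneR x) = OneR (f x)"
| "rename f (BotR x D) = BotR (f x) (rename f D)"
| "rename f (FpR x D) = FpR (f x) (rename (lift f) D)"
| "rename f (WkR x A D) = WkR (f x) A (rename f D)"
| "rename f (AbsR x D) = AbsR (f x) (rename (lift f) D)"

text \<open>
  Name adjustments: \<open>ins k\<close> makes room for a new name \<open>k\<close>, \<open>del k\<close> closes the gap at an
  unused name \<open>k\<close>, and \<open>rot k\<close> moves the name \<open>k\<close> to position 0.
\<close>

definition ins :: "nat \<Rightarrow> nat \<Rightarrow> nat" where
  "ins k n = (if n < k then n else Suc n)"

definition del :: "nat \<Rightarrow> nat \<Rightarrow> nat" where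
  "del k n = (if n \<le> k then n else n - 1)"

definition rot :: "nat \<Rightarrow> nat \<Rightarrow> nat" where
  "rot k n = (if n < k then Suc n else if n = k then 0 else n)"

text \<open>
  The cut on \<open>A\<close> (from \<open>D\<close>) against \<open>neg A\<close> (from \<open>E\<close>), with \<open>D\<close> as left premise if \<open>b\<close>
  and as right premise otherwise. Stating each step for both values of \<open>b\<close> gives its
  mirror image as well.
\<close>

definition cut_on :: "bool \<Rightarrow> 'v form \<Rightarrow> 'v deriv \<Rightarrow> 'v deriv \<Rightarrow> 'v deriv" where
  "cut_on b A D E = (if b then CutR A D E else CutR (neg A) E D)"

text \<open>Absorption of the occurrence named \<open>y\<close> into the one named \<open>x\<close>; no other name changes.\<close>

definition absorb :: "nat \<Rightarrow> nat \<Rightarrow> 'v deriv \<Rightarrow> 'v deriv" where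
  "absorb y x D = AbsR x (rename (\<lambda>n. if n = y then 0 else Suc n) D)"

text \<open>
  In a cut, the cut occurrence is named 0 in both premises, so a rule ending a premise of
  the cut introduces the cut formula if and only if its principal name is 0. All
  formulas in the conclusion of functorial promotion count as principal, so there is no
  commutative step over \<open>FpR\<close> (nor over \<open>AxR\<close> and \<open>OneR\<close>, which have no premise).

  In \<open>fp_wk\<close> and \<open>fp_abs\<close>, the list \<open>xs\<close> enumerates, in any order, the names of the context
  \<open>\<Gamma>\<close> of the promotion. In \<open>fp_abs\<close>, the extra copy of \<open>\<Gamma>\<close> bears the fresh names \<open>x + N\<close>.
\<close>

inductive cut_step :: "'v deriv \<Rightarrow> 'v deriv \<Rightarrow> bool" where
  ax_left: "cut_step (cut_on b A (AxR 0 (Suc y) A) E) (rename (case_nat y id) E)"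
| ax_right: "cut_step (cut_on b (neg A) (AxR (Suc x) 0 A) E) (rename (case_nat x id) E)"
| par_tensor: "cut_step (cut_on b (Par A B) (ParR 0 D) (TensorR 0 E F))
    (cut_on b B (cut_on b A (rename (del 2) D) E) (rename (del 1) F))"
| bot_one: "cut_step (cut_on b Bot (BotR 0 D) (OneR 0)) (rename (del 0) D)"
| fp_fp: "cut_step (cut_on b (Bang A) (FpR 0 D) (FpR (Suc x) E))
    (FpR x (cut_on b A D (rename (rot 1) E)))"
| fp_wk: "\<lbrakk>proves D (bind A (gap \<Gamma>)); distinct xs; set xs = dom \<Gamma>\<rbrakk> \<Longrightarrow>
    cut_step (cut_on b (Bang A) (FpR 0 D) (WkR 0 (neg A) E))
      (foldr (\<lambda>x F. WkR x (the (\<Gamma> x)) F) xs (rename (del 0) E))"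
| fp_abs: "\<lbrakk>proves D (bind A (gap \<Gamma>)); distinct xs; set xs = dom \<Gamma>;
      proves E (bind (neg A) (bind (Quest (neg A)) \<Delta>)); dom \<Gamma> \<union> dom \<Delta> \<subseteq> {..<N}\<rbrakk> \<Longrightarrow>
    cut_step (cut_on b (Bang A) (FpR 0 D) (AbsR 0 E))
      (foldr (\<lambda>x. absorb (x + N) x) xs
        (cut_on b A (rename (\<lambda>n. if n = 0 then 0 else n - 1 + N) D)
          (cut_on b (Bang A) (rename (ins 1) (FpR 0 D)) (rename (rot 1) E))))"

| comm_par: "cut_step (cut_on b A (ParR (Suc x) D) E)
    (ParR x (cut_on b A (rename (rot 2) D) (rename (ins 1 \<circ> ins 1) E)))"
| comm_tensor_left: "proves D (bind B (bind A \<Gamma>)) \<Longrightarrow>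
    cut_step (cut_on b A (TensorR (Suc x) D F) E)
      (TensorR x (cut_on b A (rename (rot 1) D) (rename (ins 1) E)) (rename (del 1) F))"
| comm_tensor_right: "proves F (bind B (bind A \<Gamma>)) \<Longrightarrow>
    cut_step (cut_on b A (TensorR (Suc x) D F) E)
      (TensorR x (rename (del 1) D) (cut_on b A (rename (rot 1) F) (rename (ins 1) E)))"
| comm_bot: "cut_step (cut_on b A (BotR (Suc x) D) E) (BotR x (cut_on b A D E))"
| comm_wk: "cut_step (cut_on b A (WkR (Suc x) B D) E) (WkR x B (cut_on b A D E))"
| comm_abs: "cut_step (cut_on b A (AbsR (Suc x) D) E)
    (AbsR x (cut_on b A (rename (rot 1) D) (rename (ins 1) E)))"

| in_cut_left: "cut_step D D' \<Longrightarrow> cut_step (CutR A D E) (CutR A D' E)"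
| in_cut_right: "cut_step E E' \<Longrightarrow> cut_step (CutR A D E) (CutR A D E')"
| in_par: "cut_step D D' \<Longrightarrow> cut_step (ParR x D) (ParR x D')"
| in_tensor_left: "cut_step D D' \<Longrightarrow> cut_step (TensorR x D E) (TensorR x D' E)"
| in_tensor_right: "cut_step E E' \<Longrightarrow> cut_step (TensorR x D E) (TensorR x D E')"
| in_bot: "cut_step D D' \<Longrightarrow> cut_step (BotR x D) (BotR x D')"
| in_fp: "cut_step D D' \<Longrightarrow> cut_step (FpR x D) (FpR x D')"
| in_wk: "cut_step D D' \<Longrightarrow> cut_step (WkR x A D) (WkR x A D')"
| in_abs: "cut_step D D' \<Longrightarrow> cut_step (AbsR x D) (AbsR x D')"

end

theory Submission
  imports Defs
begin

text \<open>
  A cut between cut-free derivations normalizes, by induction on the pair (size of the cut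
  formula, total size of the two derivations). No mix rule is needed: absorption keeps
  \<open>?A\<close> in its premise, so in the step \<open>fp_abs\<close> the inner cut, on the same formula \<open>!A\<close>,
  is against a smaller derivation, and the outer cut is on the smaller formula \<open>A\<close>.
  In that step the cuts end up under the renamings of the surrounding absorptions; as
  renaming commutes with cut and preserves size, the induction hypotheses
  apply to the renamed premises, and steps need not be shown stable under renaming.
\<close>

text \<open>\<open>normalizes\<close> demands a normal form typed by the original sequent, so typing
  is carried through the closure lemmas and subject reduction is never proved on its own. Promotion
  shapes the case analysis: a cut cannot move above it. If the cut formula \<open>Quest C\<close>
  lies in the context of a promotion, the cut has to wait until the other premise, which has the
  dual \<open>Bang\<close> formula, stops commuting. Hence a premise over whose last rule the cut
  commutes is always treated first. Afterwards each premise ends in an axiom, in a promotion or in a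
  rule that introduces the cut formula, and an axiom or principal step applies. Formula size
  dominates the measure because several steps leave a cut whose premise is the result of another
  cut. Its normal form has uncontrolled size, but that outer cut is on a smaller formula.\<close>

section \<open>Sequents with shifted names\<close>

lemma bind_0 [simp]: "bind A \<Gamma> 0 = Some A"
  and bind_Suc [simp]: "bind A \<Gamma> (Suc n) = \<Gamma> n"
  and gap_0 [simp]: "gap \<Gamma> 0 = None"
  and gap_Suc [simp]: "gap \<Gamma> (Suc n) = \<Gamma> n"
  by (simp_all add: bind_def gap_def)

lemma bind_eq_Some:
  "bind A \<Gamma> n = Some C \<longleftrightarrow> n = 0 \<and> C = A \<or> (\<exists>m. n = Suc m \<and> \<Gamma> m = Some C)"
  by (cases n) auto

lemma gap_eq_Some: "gap \<Gamma> n = Some C \<longleftrightarrow> (\<exists>m. n = Suc m \<and> \<Gamma> m = Some C)"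
  by (cases n) auto

lemma sequent_eqI: "(\<Gamma> :: 'v sequent) 0 = \<Delta> 0 \<Longrightarrow> (\<And>n. \<Gamma> (Suc n) = \<Delta> (Suc n)) \<Longrightarrow> \<Gamma> = \<Delta>"
  by (rule ext) (metis not0_implies_Suc)

lemma bind_iff: "bind A \<Gamma> = \<Delta> \<longleftrightarrow> \<Delta> 0 = Some A \<and> \<Gamma> = \<Delta> \<circ> Suc"
  by (auto intro!: sequent_eqI)

lemma bind_tail: "\<Gamma> 0 = Some A \<Longrightarrow> bind A (\<Gamma> \<circ> Suc) = \<Gamma>"
  by (auto intro!: sequent_eqI)

lemma gap_tail: "\<Gamma> 0 = None \<Longrightarrow> gap (\<Gamma> \<circ> Suc) = \<Gamma>"
  by (auto intro!: sequent_eqI)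

lemma dom_bind: "dom (bind A \<Gamma>) = insert 0 (Suc ` dom \<Gamma>)"
  by (auto simp: dom_def bind_eq_Some)

lemma dom_gap: "dom (gap \<Gamma>) = Suc ` dom \<Gamma>"
  by (auto simp: dom_def gap_eq_Some)

lemma bind_comp_Suc [simp]: "bind A \<Gamma> \<circ> Suc = \<Gamma>"
  by (simp add: fun_eq_iff)

lemma bind_add_gap [simp]: "bind A \<Gamma> ++ gap \<Delta> = bind A (\<Gamma> ++ \<Delta>)"
  and gap_add_bind [simp]: "gap \<Gamma> ++ bind A \<Delta> = bind A (\<Gamma> ++ \<Delta>)"
  and gap_add_gap [simp]: "gap \<Gamma> ++ gap \<Delta> = gap (\<Gamma> ++ \<Delta>)"
  by (auto intro!: sequent_eqI simp: map_add_def split: option.splits)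

lemma map_Quest_gap [simp]: "map_option Quest \<circ> gap \<Gamma> = gap (map_option Quest \<circ> \<Gamma>)"
  by (auto intro!: sequent_eqI)

lemma dom_map_Quest [simp]: "dom (map_option Quest \<circ> \<Gamma>) = dom \<Gamma>"
  by (auto simp: dom_def)

lemma map_Quest_add [simp]:
  "map_option Quest \<circ> (\<Gamma> ++ \<Delta>) = (map_option Quest \<circ> \<Gamma>) ++ (map_option Quest \<circ> \<Delta>)"
  by (auto simp: fun_eq_iff map_add_def split: option.splits)

text \<open>Inverts a rule ending a premise of a cut. The cut occurrence is named 0, so principal
  name 0 identifies the principal formula with the cut formula, and the rest of the sequent leaves
  name 0 empty, whence \<open>gap\<close>.\<close>

lemma bind_eq_update_0:
  "\<lbrakk>bind C \<Gamma> = \<Delta>(0 \<mapsto> F); 0 \<notin> dom \<Delta>\<rbrakk> \<Longrightarrow> C = F \<and> \<Delta> = gap \<Gamma>"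
  by (auto simp: bind_iff intro!: sequent_eqI)

lemma bind_eq_update_Suc:
  assumes "bind C \<Gamma> = \<Delta>(Suc x \<mapsto> F)" and "Suc x \<notin> dom \<Delta>"
  obtains \<Gamma>' where "\<Delta> = bind C \<Gamma>'" and "\<Gamma> = \<Gamma>'(x \<mapsto> F)" and "x \<notin> dom \<Gamma>'"
proof
  have *: "(\<Delta>(Suc x \<mapsto> F)) 0 = Some C" "\<Gamma> = \<Delta>(Suc x \<mapsto> F) \<circ> Suc"
    using assms(1) by (simp_all only: bind_iff)
  then show "\<Delta> = bind C (\<Delta> \<circ> Suc)" by (simp add: bind_tail)
  show "\<Gamma> = (\<Delta> \<circ> Suc)(x \<mapsto> F)" by (simp add: *(2) fun_eq_iff)
  show "x \<notin> dom (\<Delta> \<circ> Suc)" using assms(2) by auto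
qed

text \<open>The cut occurrence belongs to exactly one premise of a tensor rule; the two alternatives
  lead to \<open>comm_tensor_left\<close> and \<open>comm_tensor_right\<close>.\<close>

lemma bind_eq_add:
  assumes "bind C \<Gamma> = \<Gamma>1 ++ \<Gamma>2" and "dom \<Gamma>1 \<inter> dom \<Gamma>2 = {}"
  obtains \<Delta>1 \<Delta>2 where "\<Gamma>1 = bind C \<Delta>1" "\<Gamma>2 = gap \<Delta>2" "\<Gamma> = \<Delta>1 ++ \<Delta>2" "dom \<Delta>1 \<inter> dom \<Delta>2 = {}"
  | \<Delta>1 \<Delta>2 where "\<Gamma>1 = gap \<Delta>1" "\<Gamma>2 = bind C \<Delta>2" "\<Gamma> = \<Delta>1 ++ \<Delta>2" "dom \<Delta>1 \<inter> dom \<Delta>2 = {}"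
proof -
  have 0: "(\<Gamma>1 ++ \<Gamma>2) 0 = Some C" and "\<Gamma> = (\<Gamma>1 ++ \<Gamma>2) \<circ> Suc"
    using assms(1) by (simp_all only: bind_iff)
  then have S: "\<Gamma> = (\<Gamma>1 \<circ> Suc) ++ (\<Gamma>2 \<circ> Suc)" 
    by (simp add: map_add_def fun_eq_iff comp_def)
  have d: "dom (\<Gamma>1 \<circ> Suc) \<inter> dom (\<Gamma>2 \<circ> Suc) = {}"
    using assms(2) by (auto simp: dom_def)
  from 0 assms(2) consider "\<Gamma>1 0 = Some C" "\<Gamma>2 0 = None" | "\<Gamma>1 0 = None" "\<Gamma>2 0 = Some C"
    by (auto simp: map_add_Some_iff dom_def)
  then show thesis
    by cases (use S d that bind_tail gap_tail in metis)+
qed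

section \<open>Renaming of sequents and derivations\<close>

text \<open>Push-forward of a sequent; the choice made by \<open>inv_into\<close> is the right one
  when \<open>f\<close> is injective on the domain. Injectivity is always taken relative to a domain
  because renamings such as \<open>del k\<close>, which identifies \<open>k\<close> with
  \<open>Suc k\<close>, are injective only where a name is missing.\<close>

definition ren :: "(nat \<Rightarrow> nat) \<Rightarrow> 'v sequent \<Rightarrow> 'v sequent" where
  "ren f \<Gamma> m = (if m \<in> f ` dom \<Gamma> then \<Gamma> (inv_into (dom \<Gamma>) f m) else None)"

lemma dom_ren [simp]: "dom (ren f \<Gamma>) = f ` dom \<Gamma>"
proof -
  have "\<Gamma> (inv_into (dom \<Gamma>) f m) \<noteq> None" if "m \<in> f ` dom \<Gamma>" for m
    using inv_into_into[OF that] by auto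
  then show ?thesis by (auto simp: ren_def dom_def)
qed

lemma ren_apply: "inj_on f (dom \<Gamma>) \<Longrightarrow> \<Gamma> n = Some A \<Longrightarrow> ren f \<Gamma> (f n) = Some A"
  by (simp add: ren_def domI)

lemma ren_unique:
  assumes i: "inj_on f (dom \<Gamma>)"
    and "\<And>n A. \<Gamma> n = Some A \<Longrightarrow> \<Gamma>' (f n) = Some A"
    and "dom \<Gamma>' \<subseteq> f ` dom \<Gamma>"
  shows "ren f \<Gamma> = \<Gamma>'"
proof
  fix m
  show "ren f \<Gamma> m = \<Gamma>' m"
  proof (cases "m \<in> f ` dom \<Gamma>")
    case True
    then obtain n A where "m = f n" "\<Gamma> n = Some A" by auto
    then show ?thesis using assms(2) by (simp add: ren_apply[OF i])
  next
    case False
    then have "m \<notin> dom \<Gamma>'" using assms(3) by blast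
    with False show ?thesis by (metis dom_ren domIff)
  qed
qed

lemma lift_0 [simp]: "lift f 0 = 0"
  and lift_Suc [simp]: "lift f (Suc n) = Suc (f n)"
  by (simp_all add: lift_def)

lemma inj_on_lift_bind: "inj_on f (dom \<Gamma>) \<Longrightarrow> inj_on (lift f) (dom (bind A \<Gamma>))"
  by (auto simp: dom_bind inj_on_def)

lemma ren_lift_bind:
  assumes "inj_on f (dom \<Gamma>)"
  shows "ren (lift f) (bind A \<Gamma>) = bind A (ren f \<Gamma>)"
  by (rule ren_unique[OF inj_on_lift_bind[OF assms]])
    (auto simp: bind_eq_Some dom_bind ren_apply[OF assms] image_image)

text \<open>Injectivity on the union keeps the two images apart; on overlapping images
  \<open>++\<close> would overwrite occurrences.\<close>

lemma ren_add:
  assumes "inj_on f (dom \<Gamma> \<union> dom \<Delta>)" and "dom \<Gamma> \<inter> dom \<Delta> = {}"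
  shows "ren f (\<Gamma> ++ \<Delta>) = ren f \<Gamma> ++ ren f \<Delta>"
    and "dom (ren f \<Gamma>) \<inter> dom (ren f \<Delta>) = {}"
proof -
  have i: "inj_on f (dom \<Gamma>)" "inj_on f (dom \<Delta>)"
    using assms(1) by (auto intro: inj_on_subset)
  show d: "dom (ren f \<Gamma>) \<inter> dom (ren f \<Delta>) = {}"
    using assms by (auto simp: inj_on_def)
  show "ren f (\<Gamma> ++ \<Delta>) = ren f \<Gamma> ++ ren f \<Delta>"
  proof (rule ren_unique)
    fix n A assume "(\<Gamma> ++ \<Delta>) n = Some A"
    then consider "\<Gamma> n = Some A" "f n \<notin> dom (ren f \<Delta>)" | "\<Delta> n = Some A"
      using d by (auto simp: map_add_Some_iff simp del: not_None_eq)
    then show "(ren f \<Gamma> ++ ren f \<Delta>) (f n) = Some A"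
      by cases (simp_all add: ren_apply[OF i(1)] ren_apply[OF i(2)] map_add_dom_app_simps)
  qed (use assms(1) in \<open>auto simp: Un_commute\<close>)
qed

lemma ren_update:
  assumes "inj_on f (dom (\<Gamma>(x \<mapsto> A)))" and "x \<notin> dom \<Gamma>"
  shows "ren f (\<Gamma>(x \<mapsto> A)) = (ren f \<Gamma>)(f x \<mapsto> A)" and "f x \<notin> dom (ren f \<Gamma>)"
    and "inj_on f (dom \<Gamma>)"
proof -
  show i: "inj_on f (dom \<Gamma>)" using assms(1) by (auto intro: inj_on_subset)
  show d: "f x \<notin> dom (ren f \<Gamma>)" using assms by (auto simp: inj_on_def)
  show "ren f (\<Gamma>(x \<mapsto> A)) = (ren f \<Gamma>)(f x \<mapsto> A)"
  proof (rule ren_unique[OF assms(1)])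
    fix n B assume n: "(\<Gamma>(x \<mapsto> A)) n = Some B"
    show "((ren f \<Gamma>)(f x \<mapsto> A)) (f n) = Some B"
    proof (cases "n = x")
      case True
      with n show ?thesis by simp
    next
      case False
      with n have "ren f \<Gamma> (f n) = Some B"
        by (simp add: ren_apply[OF i])
      moreover from this d have "f n \<noteq> f x" by (metis domI)
      ultimately show ?thesis by simp
    qed
  qed auto
qed

text \<open>Mapping \<open>Quest\<close> leaves the domain unchanged, so both sides pick the same
  preimage through \<open>inv_into\<close>.\<close>

lemma ren_map_Quest:
  "ren f (map_option Quest \<circ> \<Gamma>) = map_option Quest \<circ> ren f \<Gamma>"
  by (auto simp: ren_def fun_eq_iff dom_def)

text \<open>Injectivity on the conclusion passes to the premises, since \<open>lift\<close> fixes
  the newly bound name and maps all others to successors.\<close>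

theorem proves_rename:
  "proves D \<Gamma> \<Longrightarrow> inj_on f (dom \<Gamma>) \<Longrightarrow> proves (rename f D) (ren f \<Gamma>)"
proof (induction arbitrary: f rule: proves.induct)
  case (ax x y A)
  let ?\<Gamma> = "[x \<mapsto> A, y \<mapsto> neg A]"
  have i: "inj_on f (dom ?\<Gamma>)" by (fact ax.prems)
  then have ne: "f x \<noteq> f y" using ax.hyps inj_onD[OF i, of x y] by fastforce
  then have r: "ren f ?\<Gamma> = [f x \<mapsto> A, f y \<mapsto> neg A]"
    by (intro ren_unique[OF i]) (auto split: if_splits)
  show ?case unfolding r rename.simps using ne by (rule proves.ax)
next
  case (cut D A \<Gamma> E \<Delta>)
  have i: "inj_on f (dom \<Gamma>)" "inj_on f (dom \<Delta>)" and j: "inj_on f (dom \<Gamma> \<union> dom \<Delta>)"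
    using cut.prems by (auto intro: inj_on_subset simp: Un_commute)
  note r = ren_add[OF j cut.hyps(3)]
  show ?case unfolding r(1) rename.simps
    using cut.IH(1)[OF inj_on_lift_bind[OF i(1)]] cut.IH(2)[OF inj_on_lift_bind[OF i(2)]] r(2)
    by (intro proves.cut) (simp_all only: ren_lift_bind[OF i(1)] ren_lift_bind[OF i(2)] not_False_eq_True)
next
  case (par D A B \<Gamma> x)
  note r = ren_update[OF par.prems par.hyps(2)]
  note l = inj_on_lift_bind[OF r(3)]
  show ?case unfolding r(1) rename.simps
    using par.IH[OF inj_on_lift_bind[OF l]] r(2)
    by (intro proves.par) (simp_all only: ren_lift_bind[OF l] ren_lift_bind[OF r(3)] not_False_eq_True)
next
  case (tensor D A \<Gamma> E B \<Delta> x)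
  have x: "x \<notin> dom (\<Gamma> ++ \<Delta>)" using tensor.hyps by auto
  note u = ren_update[OF tensor.prems x]
  have i: "inj_on f (dom \<Gamma>)" "inj_on f (dom \<Delta>)" and j: "inj_on f (dom \<Gamma> \<union> dom \<Delta>)"
    using u(3) by (auto intro: inj_on_subset simp: Un_commute)
  note r = ren_add[OF j tensor.hyps(3)]
  have "f x \<notin> dom (ren f \<Gamma>) \<union> dom (ren f \<Delta>)" using u(2) by auto
  then show ?case unfolding u(1) r(1) rename.simps
    using tensor.IH(1)[OF inj_on_lift_bind[OF i(1)]] tensor.IH(2)[OF inj_on_lift_bind[OF i(2)]] r(2)
    by (intro proves.tensor) (simp_all only: ren_lift_bind[OF i(1)] ren_lift_bind[OF i(2)] not_False_eq_True)
next
  case (one x)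
  have r: "ren f [x \<mapsto> One] = [f x \<mapsto> One]"
    by (rule ren_unique) (auto split: if_splits)
  show ?case unfolding r rename.simps by (rule proves.one)
next
  case (bot D \<Gamma> x)
  note r = ren_update[OF bot.prems bot.hyps(2)]
  show ?case unfolding r(1) rename.simps
    using bot.IH[OF r(3)] r(2) by (intro proves.bot)
next
  case (fp D A \<Gamma> x)
  have x: "x \<notin> dom (map_option Quest \<circ> \<Gamma>)" using fp.hyps by simp
  note r = ren_update[OF fp.prems x]
  have i: "inj_on f (dom \<Gamma>)" using r(3) by simp
  have "f x \<notin> dom (ren f \<Gamma>)" using r(2) by simp
  then show ?case unfolding r(1) rename.simps ren_map_Quest
    using fp.IH[OF inj_on_lift_bind[OF i]]
    by (intro proves.fp) (simp_all only: ren_lift_bind[OF i] not_False_eq_True)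
next
  case (wk D \<Gamma> x A)
  note r = ren_update[OF wk.prems wk.hyps(2)]
  show ?case unfolding r(1) rename.simps
    using wk.IH[OF r(3)] r(2) by (intro proves.wk)
next
  case (abs D A \<Gamma> x)
  have "ren f \<Gamma> (f x) = Some (Quest A)"
    using ren_apply[OF abs.prems, of x] abs.hyps by auto
  then show ?case unfolding rename.simps
    using abs.IH[OF inj_on_lift_bind[OF abs.prems]]
    by (intro proves.abs) (simp_all only: ren_lift_bind[OF abs.prems])
qed

text \<open>For a concrete renaming, an explicit inverse \<open>g\<close> on the occurring names
  replaces both the injectivity proof and the choice in \<open>inv_into\<close>; what remains is
  arithmetic on names.\<close>

lemma proves_rename_by_inverse:
  assumes "proves D \<Gamma>"
    and f: "\<And>n A. \<Gamma> n = Some A \<Longrightarrow> g (f n) = n \<and> \<Gamma>' (f n) = Some A"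
    and g: "\<And>m A. \<Gamma>' m = Some A \<Longrightarrow> f (g m) = m \<and> g m \<in> dom \<Gamma>"
  shows "proves (rename f D) \<Gamma>'"
proof -
  have i: "inj_on f (dom \<Gamma>)" using f by (metis inj_on_inverseI domD)
  have "ren f \<Gamma> = \<Gamma>'"
  proof (rule ren_unique[OF i])
    show "dom \<Gamma>' \<subseteq> f ` dom \<Gamma>" using g by (metis image_eqI subsetI domD)
  qed (use f in auto)
  with proves_rename[OF assms(1) i] show ?thesis by simp
qed

lemma proves_rot_1:
  "proves D (bind B (bind A \<Gamma>)) \<Longrightarrow> proves (rename (rot 1) D) (bind A (bind B \<Gamma>))"
  by (rule proves_rename_by_inverse[where g = "rot 1"])
    (auto simp: bind_eq_Some gap_eq_Some rot_def split: if_splits)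

lemma proves_rot_2:
  "proves D (bind B (bind C (bind A \<Gamma>))) \<Longrightarrow>
    proves (rename (rot 2) D) (bind A (bind B (bind C \<Gamma>)))"
  \<comment> \<open>\<open>rot 2\<close> is a 3-cycle on the names 0, 1, 2, and this is the reverse
    cycle; \<open>rot 1\<close> is a transposition, hence its own inverse.\<close>
  by (rule proves_rename_by_inverse[where
      g = "\<lambda>n. if n = 0 then 2 else if n = 1 then 0 else if n = 2 then 1 else n"])
    (auto simp: bind_eq_Some gap_eq_Some rot_def numeral_2_eq_2 split: if_splits)

lemma proves_del_0: "proves D (gap \<Gamma>) \<Longrightarrow> proves (rename (del 0) D) \<Gamma>"
  by (rule proves_rename_by_inverse[where g = Suc]) (auto simp: bind_eq_Some gap_eq_Some del_def split: if_splits)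

lemma proves_del_1:
  "proves D (bind A (gap \<Gamma>)) \<Longrightarrow> proves (rename (del 1) D) (bind A \<Gamma>)"
  by (rule proves_rename_by_inverse[where g = "ins 1"])
    (auto simp: bind_eq_Some gap_eq_Some del_def ins_def split: if_splits)

lemma proves_del_2:
  "proves D (bind A (bind B (gap \<Gamma>))) \<Longrightarrow> proves (rename (del 2) D) (bind A (bind B \<Gamma>))"
  by (rule proves_rename_by_inverse[where g = "ins 2"])
    (auto simp: bind_eq_Some gap_eq_Some del_def ins_def numeral_2_eq_2 split: if_splits)

lemma proves_ins_1:
  "proves D (bind A \<Gamma>) \<Longrightarrow> proves (rename (ins 1) D) (bind A (gap \<Gamma>))"
  by (rule proves_rename_by_inverse[where g = "del 1"])
    (auto simp: bind_eq_Some gap_eq_Some del_def ins_def split: if_splits)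

text \<open>The contractum of a cut against an axiom: the other end \<open>y\<close> of the axiom
  replaces the cut occurrence 0, and the remaining names lose their shift.\<close>

lemma proves_case_nat:
  "proves D (bind A \<Gamma>) \<Longrightarrow> y \<notin> dom \<Gamma> \<Longrightarrow> proves (rename (case_nat y id) D) (\<Gamma>(y \<mapsto> A))"
  by (rule proves_rename_by_inverse[where g = "\<lambda>n. if n = y then 0 else Suc n"])
    (auto simp: bind_eq_Some gap_eq_Some split: if_splits)

lemma lift_comp: "lift f \<circ> lift g = lift (f \<circ> g)"
  by (auto simp: lift_def fun_eq_iff split: nat.splits)

lemma rename_rename: "rename f (rename g D) = rename (f \<circ> g) D"
  by (induction D arbitrary: f g) (simp_all add: lift_comp)

lemma cut_free_rename [simp]: "cut_free (rename f D) = cut_free D"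
  by (induction D arbitrary: f) simp_all

lemma size_rename [simp]: "size (rename f D) = size D"
  by (induction D arbitrary: f) simp_all

lemma size_neg [simp]: "size (neg A) = size A"
  by (induction A) simp_all

lemma cut_on_swap: "cut_on b A D E = cut_on (\<not> b) (neg A) E D"
  by (simp add: cut_on_def)

lemma rename_cut_on:
  "rename f (cut_on b A D E) = cut_on b A (rename (lift f) D) (rename (lift f) E)"
  by (simp add: cut_on_def)

section \<open>Normalization and its closure under the rules\<close>

definition normalizes :: "'v deriv \<Rightarrow> 'v sequent \<Rightarrow> bool" where
  "normalizes D \<Gamma> \<longleftrightarrow> (\<exists>F. cut_free F \<and> proves F \<Gamma> \<and> cut_step\<^sup>*\<^sup>* D F)"

lemma normalizes_cut_free: "cut_free D \<Longrightarrow> proves D \<Gamma> \<Longrightarrow> normalizes D \<Gamma>"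
  by (auto simp: normalizes_def)

lemma normalizes_step: "cut_step D D' \<Longrightarrow> normalizes D' \<Gamma> \<Longrightarrow> normalizes D \<Gamma>"
  by (auto simp: normalizes_def intro: converse_rtranclp_into_rtranclp)

lemma rtranclp_cong:
  "R\<^sup>*\<^sup>* x y \<Longrightarrow> (\<And>x y. R x y \<Longrightarrow> S (f x) (f y)) \<Longrightarrow> S\<^sup>*\<^sup>* (f x) (f y)"
  by (induction rule: rtranclp_induct) (auto intro: rtranclp.rtrancl_into_rtrancl)

lemma normalizes_par:
  "normalizes D (bind A (bind B \<Gamma>)) \<Longrightarrow> x \<notin> dom \<Gamma> \<Longrightarrow> normalizes (ParR x D) (\<Gamma>(x \<mapsto> Par A B))"
  unfolding normalizes_def by (metis cut_free.simps(3) proves.par rtranclp_cong in_par)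

lemma normalizes_tensor:
  assumes "normalizes D (bind A \<Gamma>)" "normalizes E (bind B \<Delta>)"
    "dom \<Gamma> \<inter> dom \<Delta> = {}" "x \<notin> dom \<Gamma> \<union> dom \<Delta>"
  shows "normalizes (TensorR x D E) ((\<Gamma> ++ \<Delta>)(x \<mapsto> Tensor A B))"
proof -
  from assms obtain D' E' where
    D': "cut_free D'" "proves D' (bind A \<Gamma>)" "cut_step\<^sup>*\<^sup>* D D'" and
    E': "cut_free E'" "proves E' (bind B \<Delta>)" "cut_step\<^sup>*\<^sup>* E E'"
    by (auto simp: normalizes_def)
  have "cut_step\<^sup>*\<^sup>* (TensorR x D E) (TensorR x D' E)"
    using D'(3) by (rule rtranclp_cong) (rule in_tensor_left)
  also have "cut_step\<^sup>*\<^sup>* \<dots> (TensorR x D' E')"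
    using E'(3) by (rule rtranclp_cong) (rule in_tensor_right)
  finally show ?thesis
    using D' E' assms(3,4) by (auto simp: normalizes_def intro!: exI[of _ "TensorR x D' E'"] proves.tensor)
qed

lemma normalizes_bot:
  "normalizes D \<Gamma> \<Longrightarrow> x \<notin> dom \<Gamma> \<Longrightarrow> normalizes (BotR x D) (\<Gamma>(x \<mapsto> Bot))"
  unfolding normalizes_def by (metis cut_free.simps(6) proves.bot rtranclp_cong in_bot)

lemma normalizes_fp:
  "normalizes D (bind A \<Gamma>) \<Longrightarrow> x \<notin> dom \<Gamma> \<Longrightarrow>
    normalizes (FpR x D) ((map_option Quest \<circ> \<Gamma>)(x \<mapsto> Bang A))"
  unfolding normalizes_def by (metis cut_free.simps(7) proves.fp rtranclp_cong in_fp)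

lemma normalizes_wk:
  "normalizes D \<Gamma> \<Longrightarrow> x \<notin> dom \<Gamma> \<Longrightarrow> normalizes (WkR x A D) (\<Gamma>(x \<mapsto> Quest A))"
  unfolding normalizes_def by (metis cut_free.simps(8) proves.wk rtranclp_cong in_wk)

lemma normalizes_abs:
  "normalizes D (bind A \<Gamma>) \<Longrightarrow> \<Gamma> x = Some (Quest A) \<Longrightarrow> normalizes (AbsR x D) \<Gamma>"
  unfolding normalizes_def by (metis cut_free.simps(9) proves.abs rtranclp_cong in_abs)

lemma cut_on_steps:
  assumes "cut_step\<^sup>*\<^sup>* D D'" and "cut_step\<^sup>*\<^sup>* E E'"
  shows "cut_step\<^sup>*\<^sup>* (cut_on b A D E) (cut_on b A D' E')"
proof -
  have "cut_step\<^sup>*\<^sup>* (cut_on b A D E) (cut_on b A D' E)"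
    using assms(1) by (rule rtranclp_cong) (auto simp: cut_on_def intro: in_cut_left in_cut_right)
  also have "cut_step\<^sup>*\<^sup>* \<dots> (cut_on b A D' E')"
    using assms(2) by (rule rtranclp_cong) (auto simp: cut_on_def intro: in_cut_left in_cut_right)
  finally show ?thesis .
qed

section \<open>Cut admissibility up to a size bound\<close>

text \<open>The second component of the measure is made explicit as \<open>k\<close>. The bound is
  strict, so \<open>k = 0\<close> is vacuous and serves as base case.\<close>

definition cut_adm :: "'v form \<Rightarrow> nat \<Rightarrow> bool" where
  "cut_adm A k \<longleftrightarrow> (\<forall>b D E \<Gamma> \<Delta>. cut_free D \<longrightarrow> cut_free E \<longrightarrow>
    proves D (bind A \<Gamma>) \<longrightarrow> proves E (bind (neg A) \<Delta>) \<longrightarrow> dom \<Gamma> \<inter> dom \<Delta> = {} \<longrightarrow>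
    size D + size E < k \<longrightarrow> normalizes (cut_on b A D E) (\<Gamma> ++ \<Delta>))"

lemma cut_admD:
  "\<lbrakk>cut_adm A k; cut_free D; cut_free E; proves D (bind A \<Gamma>); proves E (bind (neg A) \<Delta>);
    dom \<Gamma> \<inter> dom \<Delta> = {}; size D + size E < k\<rbrakk> \<Longrightarrow> normalizes (cut_on b A D E) (\<Gamma> ++ \<Delta>)"
  by (auto simp: cut_adm_def)

lemma cut_adm_neg:
  assumes "cut_adm A k"
  shows "cut_adm (neg A) k"
  unfolding cut_adm_def
proof (intro allI impI)
  fix b D E and \<Gamma> \<Delta> :: "'a sequent"
  assume *: "cut_free D" "cut_free E" "proves D (bind (neg A) \<Gamma>)" "proves E (bind (neg (neg A)) \<Delta>)"
    "dom \<Gamma> \<inter> dom \<Delta> = {}" "size D + size E < k"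
  then have "normalizes (cut_on (\<not> b) A E D) (\<Delta> ++ \<Gamma>)"
    by (intro cut_admD[OF assms]) auto
  then show "normalizes (cut_on b (neg A) D E) (\<Gamma> ++ \<Delta>)"
    using map_add_comm[OF *(5)] by (simp add: cut_on_swap[of "\<not> b"])
qed

text \<open>Passes from cut-free premises to normalizing ones. The normal forms of the premises may
  be of any size, hence admissibility for every \<open>k\<close>.\<close>

lemma normalizes_cut_on:
  assumes "\<And>k. cut_adm A k" "normalizes D (bind A \<Gamma>)" "normalizes E (bind (neg A) \<Delta>)"
    "dom \<Gamma> \<inter> dom \<Delta> = {}"
  shows "normalizes (cut_on b A D E) (\<Gamma> ++ \<Delta>)"
proof -
  from assms obtain D' E' where
    D': "cut_free D'" "proves D' (bind A \<Gamma>)" "cut_step\<^sup>*\<^sup>* D D'" and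
    E': "cut_free E'" "proves E' (bind (neg A) \<Delta>)" "cut_step\<^sup>*\<^sup>* E E'"
    by (auto simp: normalizes_def)
  have "normalizes (cut_on b A D' E') (\<Gamma> ++ \<Delta>)"
    using cut_admD[OF assms(1) D'(1) E'(1) D'(2) E'(2) assms(4)] by blast
  with cut_on_steps[OF D'(3) E'(3), of b A] show ?thesis
    unfolding normalizes_def by (meson rtranclp_trans)
qed

section \<open>Inversion of the last rule of a premise\<close>

inductive_cases provesE:
  "proves (AxR x y A) \<Gamma>" "proves (CutR A D E) \<Gamma>" "proves (ParR x D) \<Gamma>"
  "proves (TensorR x D E) \<Gamma>" "proves (OneR x) \<Gamma>" "proves (BotR x D) \<Gamma>"
  "proves (FpR x D) \<Gamma>" "proves (WkR x A D) \<Gamma>" "proves (AbsR x D) \<Gamma>"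

text \<open>Follows the left-hand sides of the \<open>comm_\<close> steps, so promotion and axiom do
  not commute even if their principal names differ from 0.\<close>

fun commutes :: "'v deriv \<Rightarrow> bool" where
  "commutes (ParR (Suc x) D) = True"
| "commutes (TensorR (Suc x) D E) = True"
| "commutes (BotR (Suc x) D) = True"
| "commutes (WkR (Suc x) A D) = True"
| "commutes (AbsR (Suc x) D) = True"
| "commutes _ = False"

lemma commutes_cases:
  assumes "commutes D"
  obtains x D' where "D = ParR (Suc x) D'"
  | x D1 D2 where "D = TensorR (Suc x) D1 D2"
  | x D' where "D = BotR (Suc x) D'"
  | x B D' where "D = WkR (Suc x) B D'"
  | x D' where "D = AbsR (Suc x) D'"
  using assms by (cases D rule: commutes.cases) auto

text \<open>A last rule with principal name 0 fixes the outermost connective of \<open>A\<close>.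
  Only two kinds of case escape this: axioms, where \<open>A\<close> is arbitrary, and
  \<open>fp_context\<close>, where \<open>A\<close> is in the context of a promotion and so begins
  with \<open>Quest\<close>.\<close>

lemma noncommuting_cases:
  assumes "\<not> commutes D" "cut_free D" "proves D (bind A \<Gamma>)"
  obtains (ax_left) y where "D = AxR 0 (Suc y) A" "\<Gamma> = [y \<mapsto> neg A]"
  | (ax_right) x B where "D = AxR (Suc x) 0 B" "A = neg B" "\<Gamma> = [x \<mapsto> B]"
  | (par) D' B C where "D = ParR 0 D'" "A = Par B C" "proves D' (bind B (bind C (gap \<Gamma>)))"
  | (tensor) D1 D2 B C \<Gamma>1 \<Gamma>2 where "D = TensorR 0 D1 D2" "A = Tensor B C"
      "proves D1 (bind B (gap \<Gamma>1))" "proves D2 (bind C (gap \<Gamma>2))"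
      "\<Gamma> = \<Gamma>1 ++ \<Gamma>2" "dom \<Gamma>1 \<inter> dom \<Gamma>2 = {}"
  | (one) "D = OneR 0" "A = One" "\<Gamma> = Map.empty"
  | (bot) D' where "D = BotR 0 D'" "A = Bot" "proves D' (gap \<Gamma>)"
  | (fp) D' B \<Gamma>' where "D = FpR 0 D'" "A = Bang B" "proves D' (bind B (gap \<Gamma>'))"
      "\<Gamma> = map_option Quest \<circ> \<Gamma>'"
  | (fp_context) x D' B C \<Gamma>' where "D = FpR (Suc x) D'" "A = Quest C"
      "proves D' (bind B (bind C \<Gamma>'))" "x \<notin> dom \<Gamma>'"
      "\<Gamma> = (map_option Quest \<circ> \<Gamma>')(x \<mapsto> Bang B)"
  | (wk) D' C where "D = WkR 0 C D'" "A = Quest C" "proves D' (gap \<Gamma>)"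
  | (abs) D' C where "D = AbsR 0 D'" "A = Quest C" "proves D' (bind C (bind (Quest C) \<Gamma>))"
proof (cases D)
  case (AxR x y B)
  with assms(3) have *: "bind A \<Gamma> = [x \<mapsto> B, y \<mapsto> neg B]" "x \<noteq> y" by (auto elim: provesE)
  then have "A = the ([x \<mapsto> B, y \<mapsto> neg B] 0)" "x = 0 \<or> y = 0"
    "\<Gamma> = [x \<mapsto> B, y \<mapsto> neg B] \<circ> Suc"
    unfolding bind_iff by (auto split: if_splits)
  \<comment> \<open>Exactly one end of the axiom is named 0; the predecessor of the other is its
    name in \<open>\<Gamma>\<close>.\<close>
  with *(2) AxR show ?thesis
    using ax_left[of "y - 1"] ax_right[of "x - 1" B] by (cases x; cases y) (auto simp: fun_eq_iff)
next
  case (CutR B D1 D2)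
  with assms(2) show ?thesis by simp
next
  case (ParR x D')
  with assms(1) have x: "x = 0" by (cases x) auto
  from assms(3) ParR x obtain B C \<Delta> where
    *: "bind A \<Gamma> = \<Delta>(0 \<mapsto> Par B C)" "0 \<notin> dom \<Delta>" and "proves D' (bind B (bind C \<Delta>))"
    by (auto elim!: provesE)
  with bind_eq_update_0[OF *] ParR x show ?thesis by (intro par) auto
next
  case (TensorR x D1 D2)
  with assms(1) have x: "x = 0" by (cases x) auto
  from assms(3)[unfolded TensorR x] obtain B C \<Delta>1 \<Delta>2 where
    *: "bind A \<Gamma> = (\<Delta>1 ++ \<Delta>2)(0 \<mapsto> Tensor B C)" "0 \<notin> dom \<Delta>1" "0 \<notin> dom \<Delta>2"
    and p: "proves D1 (bind B \<Delta>1)" "proves D2 (bind C \<Delta>2)" "dom \<Delta>1 \<inter> dom \<Delta>2 = {}"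
    by (elim provesE) blast
  from * have "A = Tensor B C" and g: "\<Delta>1 ++ \<Delta>2 = gap \<Gamma>"
    using bind_eq_update_0[of A \<Gamma> "\<Delta>1 ++ \<Delta>2"] by auto
  from * have t: "gap (\<Delta>1 \<circ> Suc) = \<Delta>1" "gap (\<Delta>2 \<circ> Suc) = \<Delta>2" by (auto intro!: gap_tail)
  show ?thesis
  proof (rule tensor)
    show "D = TensorR 0 D1 D2" using TensorR x by simp
    show "\<Gamma> = (\<Delta>1 \<circ> Suc) ++ (\<Delta>2 \<circ> Suc)"
      using g by (metis gap_Suc gap_add_gap t ext)
    show "dom (\<Delta>1 \<circ> Suc) \<inter> dom (\<Delta>2 \<circ> Suc) = {}" using p(3) by (auto simp: dom_def)
  qed (use p t \<open>A = Tensor B C\<close> in simp_all)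
next
  case (OneR x)
  with assms(3) have *: "bind A \<Gamma> = [x \<mapsto> One]" by (auto elim: provesE)
  then have "[x \<mapsto> One] 0 = Some A" "\<Gamma> = [x \<mapsto> One] \<circ> Suc" unfolding bind_iff by auto
  with OneR show ?thesis by (intro one) (auto split: if_splits simp: fun_eq_iff)
next
  case (BotR x D')
  with assms(1) have x: "x = 0" by (cases x) auto
  from assms(3) BotR x obtain \<Delta> where
    *: "bind A \<Gamma> = \<Delta>(0 \<mapsto> Bot)" "0 \<notin> dom \<Delta>" and "proves D' \<Delta>"
    by (auto elim!: provesE)
  with bind_eq_update_0[OF *] BotR x show ?thesis by (intro bot) auto
next
  case (FpR x D')
  from assms(3) FpR obtain B \<Delta> where
    *: "bind A \<Gamma> = (map_option Quest \<circ> \<Delta>)(x \<mapsto> Bang B)" "x \<notin> dom (map_option Quest \<circ> \<Delta>)"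
    and p: "proves D' (bind B \<Delta>)"
    by (auto elim!: provesE)
  show ?thesis
  proof (cases x)
    case 0
    have A: "A = Bang B" and q: "map_option Quest \<circ> \<Delta> = gap \<Gamma>"
      using bind_eq_update_0[of A \<Gamma> "map_option Quest \<circ> \<Delta>"] * 0 by auto
    have t: "gap (\<Delta> \<circ> Suc) = \<Delta>" using *(2) 0 by (intro gap_tail) auto
    have "\<Gamma> = map_option Quest \<circ> (\<Delta> \<circ> Suc)"
      using q by (metis comp_assoc comp_apply ext gap_Suc)
    with A t p FpR 0 show ?thesis by (intro fp[of D' B "\<Delta> \<circ> Suc"]) auto
  next
    case (Suc z)
    from bind_eq_update_Suc[OF *[unfolded Suc]] obtain \<Gamma>' where
      r: "map_option Quest \<circ> \<Delta> = bind A \<Gamma>'" "\<Gamma> = \<Gamma>'(z \<mapsto> Bang B)" "z \<notin> dom \<Gamma>'" by blast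
    \<comment> \<open>Here the cut occurrence is in the context of the promotion, where every
      formula has received a \<open>Quest\<close>; removing it gives \<open>C\<close>.\<close>
    then have "map_option Quest (\<Delta> 0) = Some A" by (metis comp_apply bind_0)
    then obtain C where C: "\<Delta> 0 = Some C" "A = Quest C" by auto
    have \<Gamma>': "\<Gamma>' = map_option Quest \<circ> (\<Delta> \<circ> Suc)"
      using r(1) by (metis comp_assoc bind_comp_Suc)
    show ?thesis
      by (rule fp_context[of z D' C B "\<Delta> \<circ> Suc"])
        (use FpR Suc C p r \<Gamma>' in \<open>simp_all add: bind_tail\<close>)
  qed
next
  case (WkR x B D')
  with assms(1) have x: "x = 0" by (cases x) auto
  from assms(3) WkR x obtain \<Delta> where
    *: "bind A \<Gamma> = \<Delta>(0 \<mapsto> Quest B)" "0 \<notin> dom \<Delta>" and "proves D' \<Delta>"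
    by (auto elim!: provesE)
  with bind_eq_update_0[OF *] WkR x show ?thesis by (intro wk) auto
next
  case (AbsR x D')
  with assms(1) have x: "x = 0" by (cases x) auto
  from assms(3) AbsR x obtain B where "proves D' (bind B (bind A \<Gamma>))" "A = Quest B"
    by (auto elim!: provesE)
  with AbsR x show ?thesis by (intro abs[of D' B]) auto
qed

section \<open>Commutative steps\<close>

text \<open>The cut formula stays the same while \<open>D\<close> is replaced by a premise of its
  last rule, so the total size falls strictly below \<open>k\<close>; the rule is then applied to
  the normal form of the new cut.\<close>

lemma normalizes_commute:
  assumes "cut_adm A k" "commutes D" "cut_free D" "cut_free E"
    "proves D (bind A \<Gamma>)" "proves E (bind (neg A) \<Delta>)" "dom \<Gamma> \<inter> dom \<Delta> = {}"
    "size D + size E \<le> k"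
  shows "normalizes (cut_on b A D E) (\<Gamma> ++ \<Delta>)"
  using assms(2)
proof (cases rule: commutes_cases)
  case (1 x D')
  from assms(5) 1 obtain B C \<Gamma>0 where
    *: "bind A \<Gamma> = \<Gamma>0(Suc x \<mapsto> Par B C)" "Suc x \<notin> dom \<Gamma>0" and p: "proves D' (bind B (bind C \<Gamma>0))"
    by (auto elim!: provesE)
  from bind_eq_update_Suc[OF *] obtain \<Gamma>' where
    r: "\<Gamma>0 = bind A \<Gamma>'" "\<Gamma> = \<Gamma>'(x \<mapsto> Par B C)" "x \<notin> dom \<Gamma>'" by blast
  have x: "x \<notin> dom \<Delta>" and d: "dom \<Gamma>' \<inter> dom \<Delta> = {}" using assms(7) r(2) by auto
  \<comment> \<open>The new cut stands above the par rule, so its conclusion has \<open>B\<close>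
    and \<open>C\<close> at names 0 and 1; two insertions keep these names free in the context of
    \<open>E\<close>.\<close>
  have "normalizes (cut_on b A (rename (rot 2) D') (rename (ins 1 \<circ> ins 1) E))
      (bind B (bind C \<Gamma>') ++ gap (gap \<Delta>))"
  proof (rule cut_admD[OF assms(1)])
    show "proves (rename (rot 2) D') (bind A (bind B (bind C \<Gamma>')))"
      using p r(1) by (simp add: proves_rot_2)
    show "proves (rename (ins 1 \<circ> ins 1) E) (bind (neg A) (gap (gap \<Delta>)))"
      using proves_ins_1[OF proves_ins_1[OF assms(6)]] by (simp only: rename_rename)
  qed (use assms 1 d in \<open>auto simp: dom_bind dom_gap\<close>)
  then have "normalizes (ParR x (cut_on b A (rename (rot 2) D') (rename (ins 1 \<circ> ins 1) E)))
      ((\<Gamma>' ++ \<Delta>)(x \<mapsto> Par B C))"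
    using x r(3) by (intro normalizes_par) auto
  then show ?thesis unfolding 1 r(2) map_add_upd_left[OF x]
    by (rule normalizes_step[OF comm_par])
next
  case (2 x D1 D2)
  from assms(5)[unfolded 2] obtain B C \<Gamma>1 \<Gamma>2 where
    *: "bind A \<Gamma> = (\<Gamma>1 ++ \<Gamma>2)(Suc x \<mapsto> Tensor B C)"
    and "Suc x \<notin> dom \<Gamma>1" "Suc x \<notin> dom \<Gamma>2"
    and p: "proves D1 (bind B \<Gamma>1)" "proves D2 (bind C \<Gamma>2)" "dom \<Gamma>1 \<inter> dom \<Gamma>2 = {}"
    by (elim provesE) blast
  then have "Suc x \<notin> dom (\<Gamma>1 ++ \<Gamma>2)" by simp
  note * = * this
  from bind_eq_update_Suc[OF *] obtain \<Gamma>' where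
    r: "\<Gamma>1 ++ \<Gamma>2 = bind A \<Gamma>'" "\<Gamma> = \<Gamma>'(x \<mapsto> Tensor B C)" "x \<notin> dom \<Gamma>'" by blast
  have x: "x \<notin> dom \<Delta>" and d: "dom \<Gamma>' \<inter> dom \<Delta> = {}" using assms(7) r(2) by auto
  have E: "proves (rename (ins 1) E) (bind (neg A) (gap \<Delta>))"
    using assms(6) by (rule proves_ins_1)
  from r(1)[symmetric] p(3) show ?thesis
  proof (cases rule: bind_eq_add)
    case (1 \<Delta>1 \<Delta>2)
    have d': "dom \<Delta>1 \<inter> dom \<Delta> = {}" "dom \<Delta>2 \<inter> dom \<Delta> = {}" using d 1(3) by auto
    have "normalizes (cut_on b A (rename (rot 1) D1) (rename (ins 1) E)) (bind B \<Delta>1 ++ gap \<Delta>)"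
      using E p(1) 1(1) assms(3,4,8) 2 d'
      by (intro cut_admD[OF assms(1)] proves_rot_1) (auto simp: dom_bind dom_gap)
    moreover have "normalizes (rename (del 1) D2) (bind C \<Delta>2)"
      using p(2) 1(2) assms(3) 2 proves_del_1 by (intro normalizes_cut_free) auto
    ultimately have n: "normalizes (TensorR x (cut_on b A (rename (rot 1) D1) (rename (ins 1) E))
        (rename (del 1) D2)) (((\<Delta>1 ++ \<Delta>) ++ \<Delta>2)(x \<mapsto> Tensor B C))"
      using 1(3,4) d' r(3) x by (intro normalizes_tensor) auto
    have e: "(\<Delta>1 ++ \<Delta>) ++ \<Delta>2 = \<Gamma>' ++ \<Delta>"
      using map_add_comm[OF d'(2)] 1(3) by (metis map_add_assoc)
    have q: "proves D1 (bind B (bind A \<Delta>1))" using p(1) 1(1) by simp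
    show ?thesis unfolding 2 r(2) map_add_upd_left[OF x]
      using n unfolding e by (rule normalizes_step[OF comm_tensor_left[OF q]])
  next
    case (2 \<Delta>1 \<Delta>2)
    note D = \<open>D = TensorR (Suc x) D1 D2\<close>
    have d': "dom \<Delta>1 \<inter> dom \<Delta> = {}" "dom \<Delta>2 \<inter> dom \<Delta> = {}" using d 2(3) by auto
    have "normalizes (cut_on b A (rename (rot 1) D2) (rename (ins 1) E)) (bind C \<Delta>2 ++ gap \<Delta>)"
      using E p(2) 2(2) assms(3,4,8) D d'
      by (intro cut_admD[OF assms(1)] proves_rot_1) (auto simp: dom_bind dom_gap)
    moreover have "normalizes (rename (del 1) D1) (bind B \<Delta>1)"
      using p(1) 2(1) assms(3) D proves_del_1 by (intro normalizes_cut_free) auto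
    ultimately have n: "normalizes (TensorR x (rename (del 1) D1)
        (cut_on b A (rename (rot 1) D2) (rename (ins 1) E)))
        ((\<Delta>1 ++ (\<Delta>2 ++ \<Delta>))(x \<mapsto> Tensor B C))"
      using 2(3,4) d' r(3) x by (intro normalizes_tensor) auto
    have e: "\<Delta>1 ++ (\<Delta>2 ++ \<Delta>) = \<Gamma>' ++ \<Delta>"
      using 2(3) by simp
    have q: "proves D2 (bind C (bind A \<Delta>2))" using p(2) 2(2) by simp
    show ?thesis unfolding D r(2) map_add_upd_left[OF x]
      using n unfolding e by (rule normalizes_step[OF comm_tensor_right[OF q]])
  qed
next
  case (3 x D')
  from assms(5) 3 obtain \<Gamma>0 where
    *: "bind A \<Gamma> = \<Gamma>0(Suc x \<mapsto> Bot)" "Suc x \<notin> dom \<Gamma>0" and p: "proves D' \<Gamma>0"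
    by (auto elim!: provesE)
  from bind_eq_update_Suc[OF *] obtain \<Gamma>' where
    r: "\<Gamma>0 = bind A \<Gamma>'" "\<Gamma> = \<Gamma>'(x \<mapsto> Bot)" "x \<notin> dom \<Gamma>'" by blast
  have x: "x \<notin> dom \<Delta>" and d: "dom \<Gamma>' \<inter> dom \<Delta> = {}" using assms(7) r(2) by auto
  have "normalizes (cut_on b A D' E) (\<Gamma>' ++ \<Delta>)"
    using p r(1) assms(3,4,6,8) d 3 by (intro cut_admD[OF assms(1)]) auto
  then have "normalizes (BotR x (cut_on b A D' E)) ((\<Gamma>' ++ \<Delta>)(x \<mapsto> Bot))"
    using x r(3) by (intro normalizes_bot) auto
  then show ?thesis unfolding 3 r(2) map_add_upd_left[OF x]
    by (rule normalizes_step[OF comm_bot])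
next
  case (4 x B D')
  from assms(5) 4 obtain \<Gamma>0 where
    *: "bind A \<Gamma> = \<Gamma>0(Suc x \<mapsto> Quest B)" "Suc x \<notin> dom \<Gamma>0" and p: "proves D' \<Gamma>0"
    by (auto elim!: provesE)
  from bind_eq_update_Suc[OF *] obtain \<Gamma>' where
    r: "\<Gamma>0 = bind A \<Gamma>'" "\<Gamma> = \<Gamma>'(x \<mapsto> Quest B)" "x \<notin> dom \<Gamma>'" by blast
  have x: "x \<notin> dom \<Delta>" and d: "dom \<Gamma>' \<inter> dom \<Delta> = {}" using assms(7) r(2) by auto
  have "normalizes (cut_on b A D' E) (\<Gamma>' ++ \<Delta>)"
    using p r(1) assms(3,4,6,8) d 4 by (intro cut_admD[OF assms(1)]) auto
  then have "normalizes (WkR x B (cut_on b A D' E)) ((\<Gamma>' ++ \<Delta>)(x \<mapsto> Quest B))"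
    using x r(3) by (intro normalizes_wk) auto
  then show ?thesis unfolding 4 r(2) map_add_upd_left[OF x]
    by (rule normalizes_step[OF comm_wk])
next
  case (5 x D')
  from assms(5) 5 obtain B where
    q: "\<Gamma> x = Some (Quest B)" and p: "proves D' (bind B (bind A \<Gamma>))"
    by (auto elim!: provesE)
  have "normalizes (cut_on b A (rename (rot 1) D') (rename (ins 1) E)) (bind B \<Gamma> ++ gap \<Delta>)"
    using p assms(3,4,6,7,8) 5
    by (intro cut_admD[OF assms(1)] proves_rot_1 proves_ins_1) (auto simp: dom_bind dom_gap)
  \<comment> \<open>Absorption keeps its principal occurrence in the context; by disjointness the
    right-biased \<open>++\<close> does not override it.\<close>
  moreover have "(\<Gamma> ++ \<Delta>) x = Some (Quest B)"
    using q assms(7) by (auto simp: map_add_Some_iff dom_def)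
  ultimately have "normalizes (AbsR x (cut_on b A (rename (rot 1) D') (rename (ins 1) E))) (\<Gamma> ++ \<Delta>)"
    by (intro normalizes_abs[of _ B]) auto
  then show ?thesis unfolding 5 by (rule normalizes_step[OF comm_abs])
qed

section \<open>Principal steps other than absorption\<close>

lemma normalizes_cut_on_swap:
  assumes "normalizes (cut_on (\<not> b) (neg A) E D) (\<Delta> ++ \<Gamma>)" "dom \<Gamma> \<inter> dom \<Delta> = {}"
  shows "normalizes (cut_on b A D E) (\<Gamma> ++ \<Delta>)"
  using assms map_add_comm[OF assms(2)] by (simp add: cut_on_swap[of b])

lemma normalizes_cut_ax_left:
  assumes "cut_free E" "proves E (bind (neg A) \<Delta>)" "y \<notin> dom \<Delta>"
  shows "normalizes (cut_on b A (AxR 0 (Suc y) A) E) ([y \<mapsto> neg A] ++ \<Delta>)"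
proof (rule normalizes_step[OF cut_step.ax_left])
  have "[y \<mapsto> neg A] ++ \<Delta> = \<Delta>(y \<mapsto> neg A)"
    using assms(3) by (simp add: map_add_upd_left)
  then show "normalizes (rename (case_nat y id) E) ([y \<mapsto> neg A] ++ \<Delta>)"
    using assms by (simp add: normalizes_cut_free proves_case_nat)
qed

lemma normalizes_cut_ax_right:
  assumes "cut_free E" "proves E (bind A \<Delta>)" "x \<notin> dom \<Delta>"
  shows "normalizes (cut_on b (neg A) (AxR (Suc x) 0 A) E) ([x \<mapsto> A] ++ \<Delta>)"
proof (rule normalizes_step[OF cut_step.ax_right])
  have "[x \<mapsto> A] ++ \<Delta> = \<Delta>(x \<mapsto> A)"
    using assms(3) by (simp add: map_add_upd_left)
  then show "normalizes (rename (case_nat x id) E) ([x \<mapsto> A] ++ \<Delta>)"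
    using assms by (simp add: normalizes_cut_free proves_case_nat)
qed

lemma normalizes_par_tensor:
  assumes "\<And>k. cut_adm A k" "\<And>k. cut_adm B k" "cut_free D" "cut_free E" "cut_free F"
    "proves D (bind A (bind B (gap \<Gamma>)))" "proves E (bind (neg A) (gap \<Delta>1))"
    "proves F (bind (neg B) (gap \<Delta>2))" "dom \<Gamma> \<inter> dom (\<Delta>1 ++ \<Delta>2) = {}" "dom \<Delta>1 \<inter> dom \<Delta>2 = {}"
  shows "normalizes (cut_on b (Par A B) (ParR 0 D) (TensorR 0 E F)) (\<Gamma> ++ (\<Delta>1 ++ \<Delta>2))"
proof (rule normalizes_step[OF cut_step.par_tensor])
  have "normalizes (cut_on b A (rename (del 2) D) E) (bind B \<Gamma> ++ gap \<Delta>1)"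
    using assms by (intro normalizes_cut_on normalizes_cut_free proves_del_2)
      (auto simp: dom_bind dom_gap)
  moreover have "normalizes (rename (del 1) F) (bind (neg B) \<Delta>2)"
    using assms proves_del_1 by (intro normalizes_cut_free) auto
  ultimately have "normalizes (cut_on b B (cut_on b A (rename (del 2) D) E) (rename (del 1) F))
      ((\<Gamma> ++ \<Delta>1) ++ \<Delta>2)"
    using assms by (intro normalizes_cut_on) auto
  then show "normalizes (cut_on b B (cut_on b A (rename (del 2) D) E) (rename (del 1) F))
      (\<Gamma> ++ (\<Delta>1 ++ \<Delta>2))"
    by simp
qed

lemma normalizes_fp_fp:
  assumes "\<And>k. cut_adm A k" "cut_free D" "cut_free E"
    "proves D (bind A (gap \<Gamma>))" "proves E (bind B (bind (neg A) \<Delta>))"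
    "x \<notin> dom \<Gamma> \<union> dom \<Delta>" "dom \<Gamma> \<inter> dom \<Delta> = {}"
  shows "normalizes (cut_on b (Bang A) (FpR 0 D) (FpR (Suc x) E))
    ((map_option Quest \<circ> \<Gamma>) ++ (map_option Quest \<circ> \<Delta>)(x \<mapsto> Bang B))"
proof (rule normalizes_step[OF cut_step.fp_fp])
  have "normalizes (cut_on b A D (rename (rot 1) E)) (gap \<Gamma> ++ bind B \<Delta>)"
    using assms by (intro normalizes_cut_on normalizes_cut_free proves_rot_1)
      (auto simp: dom_bind dom_gap)
  then have "normalizes (FpR x (cut_on b A D (rename (rot 1) E)))
      ((map_option Quest \<circ> (\<Gamma> ++ \<Delta>))(x \<mapsto> Bang B))"
    using assms by (intro normalizes_fp) auto
  then show "normalizes (FpR x (cut_on b A D (rename (rot 1) E)))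
      ((map_option Quest \<circ> \<Gamma>) ++ (map_option Quest \<circ> \<Delta>)(x \<mapsto> Bang B))"
    by simp
qed

text \<open>Supplies the enumeration \<open>xs\<close> required by \<open>fp_wk\<close> and
  \<open>fp_abs\<close>, and the bound \<open>N\<close> required by \<open>fp_abs\<close>.\<close>

lemma proves_finite: "proves D \<Gamma> \<Longrightarrow> finite (dom \<Gamma>)"
proof (induction rule: proves.induct)
  case (fp D A \<Gamma> x)
  then have "finite (dom ((map_option Quest \<circ> \<Gamma>)(x \<mapsto> Bang A)))"
    by (simp add: dom_bind finite_image_iff)
  then show ?case .
qed (auto simp: dom_bind finite_image_iff simp del: fun_upd_apply)

text \<open>The restriction to \<open>set xs\<close> describes the sequent after part of the
  weakenings; it is all of the promoted context once \<open>xs\<close> enumerates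
  \<open>dom \<Gamma>\<close>.\<close>

lemma proves_weakenings:
  assumes "proves D \<Delta>" "distinct xs" "set xs \<subseteq> dom \<Gamma>" "dom \<Gamma> \<inter> dom \<Delta> = {}"
  shows "proves (foldr (\<lambda>x. WkR x (the (\<Gamma> x))) xs D) ((map_option Quest \<circ> \<Gamma>) |` set xs ++ \<Delta>)"
  using assms(2,3)
proof (induction xs)
  case Nil
  then show ?case using assms(1) by simp
next
  case (Cons x xs)
  have x: "x \<notin> dom \<Delta>" using Cons.prems assms(4) by auto
  let ?\<Sigma> = "(map_option Quest \<circ> \<Gamma>) |` set xs ++ \<Delta>"
  have c: "(map_option Quest \<circ> \<Gamma>) |` set (x # xs) = ((map_option Quest \<circ> \<Gamma>) |` set xs)(x \<mapsto> Quest (the (\<Gamma> x)))"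
    using Cons.prems by (auto simp: restrict_map_def fun_eq_iff)
  have f: "foldr (\<lambda>x. WkR x (the (\<Gamma> x))) (x # xs) D =
      WkR x (the (\<Gamma> x)) (foldr (\<lambda>x. WkR x (the (\<Gamma> x))) xs D)"
    by simp
  have "proves (WkR x (the (\<Gamma> x)) (foldr (\<lambda>x. WkR x (the (\<Gamma> x))) xs D))
      (?\<Sigma>(x \<mapsto> Quest (the (\<Gamma> x))))"
  proof (rule proves.wk)
    show "proves (foldr (\<lambda>x. WkR x (the (\<Gamma> x))) xs D) ?\<Sigma>" using Cons by (intro Cons.IH) auto
    show "x \<notin> dom ?\<Sigma>" using Cons.prems x by auto
  qed
  then show ?case unfolding c f map_add_upd_left[OF x] .
qed

lemma normalizes_fp_wk:
  assumes "cut_free E" "proves D (bind A (gap \<Gamma>))" "proves E (gap \<Delta>)" "dom \<Gamma> \<inter> dom \<Delta> = {}"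
  shows "normalizes (cut_on b (Bang A) (FpR 0 D) (WkR 0 (neg A) E)) ((map_option Quest \<circ> \<Gamma>) ++ \<Delta>)"
proof -
  have "finite (dom \<Gamma>)"
    using proves_finite[OF assms(2)] by (simp add: dom_bind dom_gap finite_image_iff)
  then obtain xs where xs: "distinct xs" "set xs = dom \<Gamma>"
    by (metis finite_distinct_list)
  let ?F = "foldr (\<lambda>x. WkR x (the (\<Gamma> x))) xs (rename (del 0) E)"
  have r: "(map_option Quest \<circ> \<Gamma>) |` set xs = map_option Quest \<circ> \<Gamma>"
    by (rule ext) (simp add: restrict_map_def xs(2) domIff)
  have "proves ?F ((map_option Quest \<circ> \<Gamma>) ++ \<Delta>)"
    using proves_weakenings[OF proves_del_0[OF assms(3)] xs(1) equalityD1[OF xs(2)] assms(4)]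
    unfolding r .
  moreover have "cut_free ?F"
    by (induction xs) (simp_all add: assms(1))
  ultimately have "normalizes ?F ((map_option Quest \<circ> \<Gamma>) ++ \<Delta>)"
    by (simp only: normalizes_cut_free)
  then show ?thesis
    by (rule normalizes_step[OF cut_step.fp_wk[OF assms(2) xs]])
qed

section \<open>The absorption step\<close>

text \<open>Each \<open>absorb\<close> puts a renaming around its premise, and iterated absorptions
  compose these. Quantifying over all \<open>h\<close> gives an invariant that survives the
  composition.\<close>

definition ren_normalizes :: "'v deriv \<Rightarrow> 'v sequent \<Rightarrow> bool" where
  "ren_normalizes D \<Gamma> \<longleftrightarrow> (\<forall>h. inj_on h (dom \<Gamma>) \<longrightarrow> normalizes (rename h D) (ren h \<Gamma>))"

lemma ren_normalizesD: "ren_normalizes D \<Gamma> \<Longrightarrow> inj_on h (dom \<Gamma>) \<Longrightarrow> normalizes (rename h D) (ren h \<Gamma>)"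
  by (simp add: ren_normalizes_def)

lemma rename_ident: "rename (\<lambda>n. n) D = D"
proof -
  have [simp]: "lift (\<lambda>n. n) = (\<lambda>n. n)" by (auto simp: lift_def fun_eq_iff split: nat.splits)
  show ?thesis by (induction D) simp_all
qed

lemma normalizes_if_ren_normalizes:
  assumes "ren_normalizes D \<Gamma>"
  shows "normalizes D \<Gamma>"
proof -
  have "ren (\<lambda>n. n) \<Gamma> = \<Gamma>" by (rule ren_unique) auto
  then show ?thesis using ren_normalizesD[OF assms, of "\<lambda>n. n"] by (simp add: rename_ident)
qed

lemma ren_normalizes_cut_free: "cut_free D \<Longrightarrow> proves D \<Gamma> \<Longrightarrow> ren_normalizes D \<Gamma>"
  by (simp add: ren_normalizes_def normalizes_cut_free proves_rename)

lemma ren_normalizes_cut_onI: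
  assumes "dom \<Gamma> \<inter> dom \<Delta> = {}"
    and "\<And>h. \<lbrakk>inj_on h (dom \<Gamma>); inj_on h (dom \<Delta>); dom (ren h \<Gamma>) \<inter> dom (ren h \<Delta>) = {}\<rbrakk> \<Longrightarrow>
      normalizes (cut_on b A (rename (lift h) D) (rename (lift h) E)) (ren h \<Gamma> ++ ren h \<Delta>)"
  shows "ren_normalizes (cut_on b A D E) (\<Gamma> ++ \<Delta>)"
  unfolding ren_normalizes_def rename_cut_on
proof (intro allI impI)
  fix h :: "nat \<Rightarrow> nat"
  assume h: "inj_on h (dom (\<Gamma> ++ \<Delta>))"
  then have i: "inj_on h (dom \<Gamma>)" "inj_on h (dom \<Delta>)" and "inj_on h (dom \<Gamma> \<union> dom \<Delta>)"
    by (auto intro: inj_on_subset simp: Un_commute)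
  then show "normalizes (cut_on b A (rename (lift h) D) (rename (lift h) E)) (ren h (\<Gamma> ++ \<Delta>))"
    using ren_add[of h \<Gamma> \<Delta>] assms(1) assms(2)[OF i] by metis
qed

lemma ren_normalizes_cut_on:
  assumes "\<And>k. cut_adm A k" "ren_normalizes D (bind A \<Gamma>)" "ren_normalizes E (bind (neg A) \<Delta>)"
    "dom \<Gamma> \<inter> dom \<Delta> = {}"
  shows "ren_normalizes (cut_on b A D E) (\<Gamma> ++ \<Delta>)"
proof (rule ren_normalizes_cut_onI[OF assms(4)])
  fix h :: "nat \<Rightarrow> nat"
  assume i: "inj_on h (dom \<Gamma>)" "inj_on h (dom \<Delta>)" and d: "dom (ren h \<Gamma>) \<inter> dom (ren h \<Delta>) = {}"
  from ren_normalizesD[OF assms(2) inj_on_lift_bind[OF i(1)]]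
    ren_normalizesD[OF assms(3) inj_on_lift_bind[OF i(2)]]
  show "normalizes (cut_on b A (rename (lift h) D) (rename (lift h) E)) (ren h \<Gamma> ++ ren h \<Delta>)"
    by (intro normalizes_cut_on[OF assms(1)] d) (simp_all only: ren_lift_bind[OF i(1)] ren_lift_bind[OF i(2)] not_False_eq_True)
qed

lemma ren_normalizes_cut_adm:
  assumes "cut_adm A k" "cut_free D" "cut_free E" "proves D (bind A \<Gamma>)" "proves E (bind (neg A) \<Delta>)"
    "dom \<Gamma> \<inter> dom \<Delta> = {}" "size D + size E < k"
  shows "ren_normalizes (cut_on b A D E) (\<Gamma> ++ \<Delta>)"
proof (rule ren_normalizes_cut_onI[OF assms(6)])
  fix h :: "nat \<Rightarrow> nat"
  assume i: "inj_on h (dom \<Gamma>)" "inj_on h (dom \<Delta>)" and d: "dom (ren h \<Gamma>) \<inter> dom (ren h \<Delta>) = {}"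
  from proves_rename[OF assms(4) inj_on_lift_bind[OF i(1)]]
    proves_rename[OF assms(5) inj_on_lift_bind[OF i(2)]] assms(2,3,7)
  show "normalizes (cut_on b A (rename (lift h) D) (rename (lift h) E)) (ren h \<Gamma> ++ ren h \<Delta>)"
    by (intro cut_admD[OF assms(1)] d)
      (simp_all only: ren_lift_bind[OF i(1)] ren_lift_bind[OF i(2)] cut_free_rename size_rename)
qed

lemma ren_normalizes_absorb:
  assumes D: "ren_normalizes D \<Gamma>" and y: "\<Gamma> y = Some A" and x: "\<Gamma> x = Some (Quest A)"
  shows "ren_normalizes (absorb y x D) (\<Gamma>(y := None))"
  unfolding ren_normalizes_def
proof (intro allI impI)
  fix h :: "nat \<Rightarrow> nat"
  let ?\<Gamma> = "\<Gamma>(y := None)"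
  assume h: "inj_on h (dom ?\<Gamma>)"
  \<comment> \<open>The total renaming reaching \<open>D\<close>. It is injective although
    \<open>h\<close> is so only away from \<open>y\<close>: it sends \<open>y\<close> to 0 and all
    other names to successors.\<close>
  define g where "g = lift h \<circ> (\<lambda>n. if n = y then 0 else Suc n)"
  have g_eq: "g y = 0" "\<And>n. n \<noteq> y \<Longrightarrow> g n = Suc (h n)" by (simp_all add: g_def)
  \<comment> \<open>No formula contains itself properly, so an occurrence is never absorbed into
    itself.\<close>
  have "A \<noteq> Quest A" by (induction A) simp_all
  then have "x \<noteq> y" using x y by auto
  have app: "ren h ?\<Gamma> (h n) = Some B" if "\<Gamma> n = Some B" "n \<noteq> y" for n B
    using that by (intro ren_apply[OF h]) auto
  have g: "inj_on g (dom \<Gamma>)"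
  proof (rule inj_onI)
    fix m n assume "m \<in> dom \<Gamma>" "n \<in> dom \<Gamma>" "g m = g n"
    then show "m = n"
      using inj_onD[OF h, of m n] by (cases "m = y"; cases "n = y") (auto simp: g_eq)
  qed
  have "ren g \<Gamma> = bind A (ren h ?\<Gamma>)"
  proof (rule ren_unique[OF g])
    fix n B assume "\<Gamma> n = Some B"
    then show "bind A (ren h ?\<Gamma>) (g n) = Some B"
      using y app by (cases "n = y") (auto simp: g_eq)
  next
    have "0 \<in> g ` dom \<Gamma>" using y g_eq(1) by (metis domI imageI)
    moreover have "Suc (h n) \<in> g ` dom \<Gamma>" if "n \<in> dom \<Gamma>" "n \<noteq> y" for n
      using that g_eq(2) by (metis imageI)
    ultimately show "dom (bind A (ren h ?\<Gamma>)) \<subseteq> g ` dom \<Gamma>"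
      by (auto simp: dom_bind)
  qed
  then have "normalizes (rename g D) (bind A (ren h ?\<Gamma>))"
    using ren_normalizesD[OF D g] by simp
  moreover have "ren h ?\<Gamma> (h x) = Some (Quest A)" using app x \<open>x \<noteq> y\<close> by simp
  ultimately show "normalizes (rename h (absorb y x D)) (ren h ?\<Gamma>)"
    by (simp add: absorb_def rename_rename g_def normalizes_abs)
qed

text \<open>Names below \<open>N\<close> are never copies, and copies of distinct names are
  distinct; so the absorptions already done have removed neither \<open>x\<close> nor its copy
  \<open>x + N\<close>.\<close>

lemma ren_normalizes_absorb_all:
  assumes "ren_normalizes D \<Sigma>" "distinct xs" "\<And>x. x \<in> set xs \<Longrightarrow> x < N"
    and "\<And>x. x \<in> set xs \<Longrightarrow> \<exists>A. \<Sigma> x = Some (Quest A) \<and> \<Sigma> (x + N) = Some A"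
  shows "ren_normalizes (foldr (\<lambda>x. absorb (x + N) x) xs D)
    (\<lambda>m. if m \<in> (\<lambda>x. x + N) ` set xs then None else \<Sigma> m)"
  using assms(2-)
proof (induction xs)
  case Nil
  then show ?case using assms(1) by simp
next
  case (Cons x xs)
  let ?\<Sigma> = "\<lambda>m. if m \<in> (\<lambda>x. x + N) ` set xs then None else \<Sigma> m"
  obtain A where A: "\<Sigma> x = Some (Quest A)" "\<Sigma> (x + N) = Some A"
    using Cons.prems(3) by force
  have "ren_normalizes (foldr (\<lambda>x. absorb (x + N) x) xs D) ?\<Sigma>"
    using Cons by simp
  moreover have "x < N" "x \<notin> set xs" using Cons.prems by auto
  ultimately have "ren_normalizes (absorb (x + N) x (foldr (\<lambda>x. absorb (x + N) x) xs D))
      (?\<Sigma>(x + N := None))"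
    using A by (intro ren_normalizes_absorb[of _ _ _ A]) auto
  moreover have "?\<Sigma>(x + N := None) = (\<lambda>m. if m \<in> (\<lambda>x. x + N) ` set (x # xs) then None else \<Sigma> m)"
    by (auto simp: fun_eq_iff)
  ultimately show ?case by simp
qed

lemma normalizes_fp_abs:
  fixes \<Gamma> \<Delta> :: "'v sequent"
  assumes "\<And>k. cut_adm A k" "cut_adm (Bang A) k" "cut_free D" "cut_free E"
    and D: "proves D (bind A (gap \<Gamma>))" and E: "proves E (bind (neg A) (bind (Quest (neg A)) \<Delta>))"
    and disj: "dom \<Gamma> \<inter> dom \<Delta> = {}" and k: "size (FpR 0 D) + size (AbsR 0 E) \<le> k"
  shows "normalizes (cut_on b (Bang A) (FpR 0 D) (AbsR 0 E)) ((map_option Quest \<circ> \<Gamma>) ++ \<Delta>)"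
proof -
  have fin: "finite (dom \<Gamma>)" "finite (dom \<Delta>)"
    using proves_finite[OF D] proves_finite[OF E] by (simp_all add: dom_bind dom_gap finite_image_iff)
  then obtain xs where xs: "distinct xs" "set xs = dom \<Gamma>"
    by (metis finite_distinct_list)
  from fin obtain N where N: "dom \<Gamma> \<union> dom \<Delta> \<subseteq> {..<N}"
    using finite_nat_set_iff_bounded[of "dom \<Gamma> \<union> dom \<Delta>"] by auto
  let ?Q = "map_option Quest \<circ> \<Gamma>"
  \<comment> \<open>The second copy of the context, not yet under \<open>Quest\<close>, at names
    beyond all those of \<open>\<Gamma>\<close> and \<open>\<Delta>\<close>.\<close>
  define \<Gamma>N where "\<Gamma>N = (\<lambda>m. if m < N then None else \<Gamma> (m - N))"
  have domN: "dom \<Gamma>N = (\<lambda>x. x + N) ` dom \<Gamma>"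
    by (auto simp: \<Gamma>N_def dom_def image_iff split: if_splits) (metis add.commute le_add_diff_inverse not_less)
  let ?C = "cut_on b (Bang A) (rename (ins 1) (FpR 0 D)) (rename (rot 1) E)"
  let ?D = "rename (\<lambda>n. if n = 0 then 0 else n - 1 + N) D"
  have "proves (FpR 0 D) ((map_option Quest \<circ> gap \<Gamma>)(0 \<mapsto> Bang A))"
    using D by (intro proves.fp) auto
  moreover have "(gap ?Q)(0 \<mapsto> Bang A) = bind (Bang A) ?Q"
    by (auto intro: sequent_eqI)
  ultimately have "proves (FpR 0 D) (bind (Bang A) ?Q)" by simp
  \<comment> \<open>The cut formula is unchanged; only the removal of the absorption above
    \<open>E\<close> brings the size below \<open>k\<close>.\<close>
  then have "ren_normalizes ?C (gap ?Q ++ bind (neg A) \<Delta>)"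
    using assms(3,4) E disj k
    by (intro ren_normalizes_cut_adm[OF assms(2)] proves_ins_1 proves_rot_1)
      (auto simp: dom_bind dom_gap)
  then have C: "ren_normalizes ?C (bind (neg A) (?Q ++ \<Delta>))" by simp
  have "proves ?D (bind A \<Gamma>N)"
    \<comment> \<open>In \<open>D\<close> names carry two shifts, one from the binder of
      \<open>A\<close> and one from the gap left for the principal \<open>Bang A\<close>; the
      renaming drops the latter and adds \<open>N\<close>.\<close>
    by (rule proves_rename_by_inverse[OF D, where g = "\<lambda>m. if m = 0 then 0 else Suc (Suc (m - 1 - N))"])
      (auto simp: bind_eq_Some gap_eq_Some \<Gamma>N_def split: if_splits)
  then have "ren_normalizes ?D (bind A \<Gamma>N)"
    using assms(3) by (intro ren_normalizes_cut_free) auto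
  moreover have "dom \<Gamma>N \<inter> dom (?Q ++ \<Delta>) = {}"
    using N by (auto simp: domN)
  \<comment> \<open>The normal form of \<open>?C\<close> has no size bound, so this cut relies on
    \<open>A\<close> being admissible for every \<open>k\<close>.\<close>
  ultimately have *: "ren_normalizes (cut_on b A ?D ?C) (\<Gamma>N ++ (?Q ++ \<Delta>))"
    using C by (intro ren_normalizes_cut_on[OF assms(1)])
  let ?\<Sigma> = "\<Gamma>N ++ (?Q ++ \<Delta>)"
  have "\<exists>B. ?\<Sigma> x = Some (Quest B) \<and> ?\<Sigma> (x + N) = Some B" if "x \<in> dom \<Gamma>" for x
  proof -
    from that obtain B where B: "\<Gamma> x = Some B" by auto
    have "x \<notin> dom \<Delta>" "x + N \<notin> dom \<Delta>" "x + N \<notin> dom \<Gamma>" using that disj N by auto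
    then have "\<Delta> x = None" "\<Delta> (x + N) = None" "\<Gamma> (x + N) = None" by auto
    with B show ?thesis by (auto simp: map_add_def \<Gamma>N_def)
  qed
  then have "ren_normalizes (foldr (\<lambda>x. absorb (x + N) x) xs (cut_on b A ?D ?C))
      (\<lambda>m. if m \<in> (\<lambda>x. x + N) ` set xs then None else ?\<Sigma> m)"
    using xs N by (intro ren_normalizes_absorb_all[OF *]) auto
  moreover have "(\<lambda>m. if m \<in> (\<lambda>x. x + N) ` set xs then None else ?\<Sigma> m) = ?Q ++ \<Delta>"
  proof
    fix m
    show "(if m \<in> (\<lambda>x. x + N) ` set xs then None else ?\<Sigma> m) = (?Q ++ \<Delta>) m"
    proof (cases "m \<in> dom \<Gamma>N")
      case True
      then have "m \<notin> dom (?Q ++ \<Delta>)" using N by (auto simp: domN)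
      then show ?thesis using True xs(2) by (metis domIff domN)
    next
      case False
      then have "?\<Sigma> m = (?Q ++ \<Delta>) m" by (rule map_add_dom_app_simps(2))
      then show ?thesis using False domN xs(2) by simp
    qed
  qed
  ultimately have "normalizes (foldr (\<lambda>x. absorb (x + N) x) xs (cut_on b A ?D ?C)) (?Q ++ \<Delta>)"
    by (simp add: normalizes_if_ren_normalizes)
  then show ?thesis
    by (rule normalizes_step[OF cut_step.fp_abs[OF D xs E N]])
qed

section \<open>Induction on the cut formula\<close>

text \<open>Not the polarity of focusing: it selects from each dual pair of compound formulas or
  units the one that the principal steps put in the first premise of \<open>cut_on\<close>. For
  atoms the choice is arbitrary.\<close>

primrec positive :: "'v form \<Rightarrow> bool" where
  "positive (Var X) = True"
| "positive (NVar X) = False"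
| "positive (Tensor A B) = False"
| "positive (Par A B) = True"
| "positive (Bang A) = True"
| "positive (Quest A) = False"
| "positive One = False"
| "positive Bot = True"

lemma positive_neg: "positive (neg A) = (\<not> positive A)"
  by (cases A) auto

text \<open>With a positive cut formula, a noncommuting \<open>D\<close> ends in an axiom or
  introduces \<open>Par\<close>, \<open>Bot\<close> or \<open>Bang\<close>; the dual shape of
  \<open>neg A\<close> then leaves for \<open>E\<close> an axiom or the partner of a principal
  step.\<close>

lemma cut_adm_Suc:
  fixes A :: "'v form"
  assumes IH: "\<And>(B :: 'v form) k. size B < size A \<Longrightarrow> cut_adm B k" and k: "cut_adm A k" and A: "positive A"
  shows "cut_adm A (Suc k)"
  unfolding cut_adm_def
proof (intro allI impI)
  fix b D E and \<Gamma> \<Delta> :: "'v sequent"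
  assume cf: "cut_free D" "cut_free E" and D: "proves D (bind A \<Gamma>)" and E: "proves E (bind (neg A) \<Delta>)"
    and disj: "dom \<Gamma> \<inter> dom \<Delta> = {}" and w: "size D + size E < Suc k"
  have swap: "dom \<Delta> \<inter> dom \<Gamma> = {}" "size E + size D \<le> k" "proves D (bind (neg (neg A)) \<Gamma>)"
    using disj w D by auto
  have comm_E: "normalizes (cut_on b A D E) (\<Gamma> ++ \<Delta>)" if "commutes E"
    by (rule normalizes_cut_on_swap[OF normalizes_commute[OF cut_adm_neg[OF k] that cf(2,1) E swap(3,1,2)] disj])
  show "normalizes (cut_on b A D E) (\<Gamma> ++ \<Delta>)"
  proof (cases "commutes D \<or> commutes E")
    case True
    then show ?thesis
      using comm_E normalizes_commute[OF k _ cf D E disj] w by auto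
  next
    case False
    then have nc: "\<not> commutes D" "\<not> commutes E" by auto
    \<comment> \<open>An axiom ending \<open>E\<close> is compatible with every last rule of
      \<open>D\<close>, so it is settled once, before the split on \<open>D\<close>.\<close>
    have ax_E: ?thesis if "(\<exists>y. E = AxR 0 (Suc y) (neg A) \<and> \<Delta> = [y \<mapsto> neg (neg A)]) \<or>
      (\<exists>x B. E = AxR (Suc x) 0 B \<and> neg A = neg B \<and> \<Delta> = [x \<mapsto> B])"
    proof (rule normalizes_cut_on_swap[OF _ disj])
      from that show "normalizes (cut_on (\<not> b) (neg A) E D) (\<Delta> ++ \<Gamma>)"
      proof (elim disjE exE conjE)
        fix y assume "E = AxR 0 (Suc y) (neg A)" "\<Delta> = [y \<mapsto> neg (neg A)]"
        then show ?thesis using normalizes_cut_ax_left[OF cf(1) swap(3)] disj by auto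
      next
        fix x B assume *: "E = AxR (Suc x) 0 B" "neg A = neg B" "\<Delta> = [x \<mapsto> B]"
        then have "A = B" by (metis neg_neg)
        with * show ?thesis using normalizes_cut_ax_right[OF cf(1) D] disj by auto
      qed
    qed
    from nc(1) cf(1) D show ?thesis
    proof (cases rule: noncommuting_cases)
      case (ax_left y)
      then show ?thesis using normalizes_cut_ax_left[OF cf(2) E] disj by auto
    next
      case (ax_right x B)
      then show ?thesis using normalizes_cut_ax_right[OF cf(2), of B] E disj by auto
    next
      case (par D' B C)
      have small: "cut_adm B j" "cut_adm C j" for j using IH[of B j] IH[of C j] par(2) by auto
      from nc(2) cf(2) E show ?thesis
      proof (cases rule: noncommuting_cases)
        case (tensor E1 E2 B' C' \<Delta>1 \<Delta>2)
        then have "normalizes (cut_on b (Par B C) (ParR 0 D') (TensorR 0 E1 E2)) (\<Gamma> ++ (\<Delta>1 ++ \<Delta>2))"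
          using par cf disj by (intro normalizes_par_tensor small) auto
        then show ?thesis using par tensor by simp
      qed (use par ax_E in auto)
    next
      case (bot D')
      from nc(2) cf(2) E show ?thesis
      proof (cases rule: noncommuting_cases)
        case one
        have "normalizes (rename (del 0) D') \<Gamma>"
          using bot cf by (intro normalizes_cut_free proves_del_0) auto
        then show ?thesis using bot one by (auto intro: normalizes_step[OF cut_step.bot_one])
      qed (use bot ax_E in auto)
    next
      case (fp D' B \<Gamma>')
      have small: "cut_adm B j" for j using IH fp(2) by auto
      from nc(2) cf(2) E show ?thesis
      proof (cases rule: noncommuting_cases)
        case (fp_context x E' B' C \<Delta>')
        have x: "x \<notin> dom \<Gamma>'" using disj fp(4) fp_context(5) by auto
        have "normalizes (cut_on b (Bang B) (FpR 0 D') (FpR (Suc x) E'))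
          ((map_option Quest \<circ> \<Gamma>') ++ (map_option Quest \<circ> \<Delta>')(x \<mapsto> Bang B'))"
          using fp fp_context cf disj x by (intro normalizes_fp_fp small) auto
        then show ?thesis unfolding fp fp_context .
      next
        case (wk E' C)
        then show ?thesis
          using fp cf disj by (auto intro!: normalizes_fp_wk)
      next
        case (abs E' C)
        have "normalizes (cut_on b (Bang B) (FpR 0 D') (AbsR 0 E')) ((map_option Quest \<circ> \<Gamma>') ++ \<Delta>)"
          using abs fp cf disj w k by (intro normalizes_fp_abs small) auto
        then show ?thesis using abs fp by simp
      qed (use fp ax_E in auto)
    \<comment> \<open>The remaining last rules introduce \<open>Tensor\<close>, \<open>One\<close>
      or \<open>Quest\<close>, or have \<open>Quest\<close> in a promoted context, contrary to
      positivity.\<close>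
    qed (use A in auto)
  qed
qed

text \<open>Size is the right measure on formulas because \<open>A\<close> and \<open>neg A\<close>
  share it: a negative \<open>A\<close> is settled through its positive dual at the same
  level.\<close>

theorem cut_adm: "cut_adm (A :: 'v form) k"
proof (induction "size A" arbitrary: A k rule: less_induct)
  case (less A k)
  have *: "cut_adm B j" if "positive B" "size B = size A" for B :: "'v form" and j
  proof (induction j)
    case 0
    show ?case by (simp add: cut_adm_def)
  next
    case (Suc j)
    show ?case using less that Suc by (intro cut_adm_Suc) auto
  qed
  show ?case
    using *[of A k] cut_adm_neg[OF *[of "neg A" k]] positive_neg[of A] by auto
qed

text \<open>Premises are normalized before the cut below them, which reduces that cut to one between
  cut-free derivations.\<close>

theorem proves_normalizes: "proves D \<Gamma> \<Longrightarrow> normalizes D \<Gamma>"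
proof (induction rule: proves.induct)
  case (ax x y A)
  then show ?case by (intro normalizes_cut_free proves.ax) auto
next
  case (cut D A \<Gamma> E \<Delta>)
  then have "normalizes (cut_on True A D E) (\<Gamma> ++ \<Delta>)"
    by (intro normalizes_cut_on cut_adm)
  then show ?case by (simp add: cut_on_def)
next
  case (one x)
  then show ?case by (intro normalizes_cut_free proves.one) auto
qed ((rule normalizes_par normalizes_tensor normalizes_bot normalizes_fp normalizes_wk normalizes_abs; assumption)+)

theorem theorem3p3:
  fixes D :: "'v deriv"
  assumes "D \<in> PLL"
  shows "\<exists>D' \<in> PLL. cut_free D' \<and> cut_step\<^sup>*\<^sup>* D D'"
  using assms proves_normalizes unfolding PLL_def normalizes_def by blast

end
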